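(* Assume that strong duality and dual strict complementarity hold for the primal SDP (P) and the dual SDP (D) (so $\Omega_{\mathrm P}\ne\emptyset$ and $\Omega_{\mathrm D}\ne\emptyset$). Let $\{X_k,w_k\}$, $w_k=(y_k,Z_k)$, be a sequence generated by the inexact augmented Lagrangian method (ALM) for (P) described in the context, under both inexactness criteria (A$'$) and (B$'$). Then the following hold. (a) (Dual iterates and KKT residuals) There exists $\hat k>0$ such that for all $k\ge\hat k$, $$\mathrm{dist}(w_{k+1},\Omega_{\mathrm D})\le\mu_k\cdot\mathrm{dist}(w_k,\Omega_{\mathrm D}),\qquad \mathrm{dist}(X_{k+1},\mathbb S^n_+)\le\mu_k'\cdot\mathrm{dist}(w_k,\Omega_{\mathrm D}),$$ $$\|\mathcal A(X_{k+1})-b\|\le\mu_k'\cdot\mathrm{dist}(w_k,\Omega_{\mathrm D}),\qquad \langle C,X_{k+1}\rangle-p^\star\le\mu_k''\cdot\mathrm{dist}(w_k,\Omega_{\mathrm D}),$$ where $0<\mu_k<1$, $\mu_k'>0$ and $\mu_k''>0$ are finite constants. (b) (Primal iterates) If $\Omega_{\mathrm P}$ is bounded, then the primal sequence $\{X_k\}$ also converges linearly to the solution set $\Omega_{\mathrm P}$, i.e., there exists a constant $\hat k>0$ such that for all $k\ge\hat k$, $$\mathrm{dist}^2(X_{k+1},\Omega_{\mathrm P})\le\tau_k\cdot\mathrm{dist}(w_k,\Omega_{\mathrm D}),$$ where $\tau_k>0$ is a finite constant.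
   Context: $\mathbb S^n$ is the space of real symmetric $n\times n$ matrices with inner product $\langle X,Y\rangle=\mathrm{tr}(XY)$ and Frobenius norm $\|\cdot\|$; $\mathbb S^n_+$ is the positive semidefinite cone and $\Pi_{\mathbb S^n_+}$ the orthogonal projection onto it; $\mathbb R^m$ carries the Euclidean norm and $\mathbb R^m\times\mathbb S^n$ the norm $\|(y,Z)\|^2=\|y\|^2+\|Z\|^2$; $\mathrm{dist}$ is the distance with respect to these norms. Data: $C\in\mathbb S^n$, $b\in\mathbb R^m$, $A_1,\dots,A_m\in\mathbb S^n$, $\mathcal A:\mathbb S^n\to\mathbb R^m$, $\mathcal A(X)=(\langle A_1,X\rangle,\dots,\langle A_m,X\rangle)^{\mathsf T}$, with adjoint $\mathcal A^*(y)=\sum_i y_iA_i$. Standing assumption: $\mathcal A$ is surjective. (P): $p^\star=\min_{X\in\mathbb S^n}\langle C,X\rangle$ subject to $\mathcal A(X)=b$, $X\in\mathbb S^n_+$. (D): $d^\star=\max_{y\in\mathbb R^m,Z\in\mathbb S^n}\langle b,y\rangle$ subject to $\mathcal A^*(y)+Z=C$, $Z\in\mathbb S^n_+$. $\Omega_{\mathrm P}=\{X\in\mathbb S^n_+\mid\langle C,X\rangle=p^\star,\mathcal A(X)=b\}$ and $\Omega_{\mathrm D}=\{(y,Z)\in\mathbb R^m\times\mathbb S^n_+\mid\langle b,y\rangle=d^\star,\mathcal A^*(y)+Z=C\}$ are the optimal solution sets. Strong duality means $p^\star=d^\star$. Dual strict complementarity means that there exist $X^\star\in\Omega_{\mathrm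 P}$, $(y^\star,Z^\star)\in\Omega_{\mathrm D}$ with $X^\star\in\mathrm{relint}\big(\mathcal N_{(\mathbb S^n_+)^\circ}(-Z^\star)\big)$, where $(\mathbb S^n_+)^\circ=-\mathbb S^n_+$ is the polar cone, $\mathcal N$ the normal cone and $\mathrm{relint}$ the relative interior. Augmented Lagrangian of (P) with parameter $r>0$, for $w=(y,Z)$: $$L_r(X,w)=\langle C,X\rangle+\frac1{2r}\Big(\|y+r(b-\mathcal A(X))\|^2+\|\Pi_{\mathbb S^n_+}(Z-rX)\|^2-\|y\|^2-\|Z\|^2\Big).$$ Inexact ALM for (P): given $w_0=(y_0,Z_0)\in\mathbb R^m\times\mathbb S^n_+$ and positive scalars $r_k\uparrow r_\infty<+\infty$ (nondecreasing), for $k=0,1,2,\dots$: $X_{k+1}\in\mathbb S^n$ is an approximate minimizer of $L_{r_k}(\cdot,w_k)$ over $\mathbb S^n$, and then $$y_{k+1}=y_k+r_k(b-\mathcal A(X_{k+1})),\qquad Z_{k+1}=\Pi_{\mathbb S^n_+}(Z_k-r_kX_{k+1}),\qquad w_{k+1}=(y_{k+1},Z_{k+1}).$$ Inexactness criteria, imposed for every $k$, with nonnegative sequences $\{\epsilon_k\},\{\delta_k\}$ (the minimum is the optimal value of the subproblem): (A$'$) $L_{r_k}(X_{k+1},w_k)-\min_{X\in\mathbb S^n}L_{r_k}(X,w_k)\le\epsilon_k^2/(2r_k)$, with $\sum_k\epsilon_k<\infty$; (B$'$) $L_{r_k}(X_{k+1},w_k)-\min_{X\in\mathbb S^n}L_{r_k}(X,w_k)\le\delta_k^2\|w_{k+1}-w_k\|^2/(2r_k)$,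 with $\sum_k\delta_k<\infty$. *)

theory Defs
  imports "HOL-Analysis.Analysis"
begin

text \<open>
  Symmetric matrices form a subspace of \<open>real ^ 'n ^ 'n\<close>, whose library norm is the Frobenius
  norm and whose library inner product is the entrywise one; on symmetric matrices the latter is
  the trace inner product (lemma \<open>inner_eq_trace\<close>). The library norm of the product type
  is the norm used on pairs \<open>(y, Z)\<close>.
\<close>

definition sym_mats :: "(real ^ 'n ^ 'n) set" where
  "sym_mats = {X. transpose X = X}"

lemma inner_eq_trace:
  fixes X Y :: "real ^ 'n ^ 'n"
  assumes "Y \<in> sym_mats"
  shows "X \<bullet> Y = trace (X ** Y)"
proof -
  have "Y $ i $ j = Y $ j $ i" for i j
    using assms unfolding sym_mats_def transpose_def by (metis (mono_tags) mem_Collect_eq vec_lambda_beta)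
  then show ?thesis
    by (simp add: inner_vec_def trace_def matrix_matrix_mult_def)
qed

definition psd_cone :: "(real ^ 'n ^ 'n) set" where
  "psd_cone = {X \<in> sym_mats. \<forall>v. 0 \<le> v \<bullet> (X *v v)}"

definition proj_psd :: "real ^ 'n ^ 'n \<Rightarrow> real ^ 'n ^ 'n" where
  "proj_psd = closest_point psd_cone"

text \<open>
  The ambient space of the polar and of the normal cone is the space of symmetric matrices,
  hence the restriction to \<open>sym_mats\<close>.
\<close>

definition polar_cone :: "(real ^ 'n ^ 'n) set \<Rightarrow> (real ^ 'n ^ 'n) set" where
  "polar_cone K = {Y \<in> sym_mats. \<forall>X\<in>K. Y \<bullet> X \<le> 0}"

definition normal_cone :: "(real ^ 'n ^ 'n) set \<Rightarrow> real ^ 'n ^ 'n \<Rightarrow> (real ^ 'n ^ 'n) set" where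
  "normal_cone K X = (if X \<in> K then {V \<in> sym_mats. \<forall>Y\<in>K. V \<bullet> (Y - X) \<le> 0} else {})"

definition sdp_op :: "('m::finite \<Rightarrow> real ^ 'n ^ 'n) \<Rightarrow> real ^ 'n ^ 'n \<Rightarrow> real ^ 'm" where
  "sdp_op A X = (\<chi> i. A i \<bullet> X)"

definition sdp_adj :: "('m::finite \<Rightarrow> real ^ 'n ^ 'n) \<Rightarrow> real ^ 'm \<Rightarrow> real ^ 'n ^ 'n" where
  "sdp_adj A y = (\<Sum>i\<in>UNIV. (y $ i) *\<^sub>R A i)"

definition sdp_data :: "real ^ 'n ^ 'n \<Rightarrow> ('m::finite \<Rightarrow> real ^ 'n ^ 'n) \<Rightarrow> bool" where
  "sdp_data C A \<longleftrightarrow>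
     C \<in> sym_mats \<and> (\<forall>i. A i \<in> sym_mats) \<and> sdp_op A ` sym_mats = UNIV"

definition primal_feasible ::
    "('m::finite \<Rightarrow> real ^ 'n ^ 'n) \<Rightarrow> real ^ 'm \<Rightarrow> (real ^ 'n ^ 'n) set" where
  "primal_feasible A b = {X \<in> psd_cone. sdp_op A X = b}"

definition dual_feasible ::
    "real ^ 'n ^ 'n \<Rightarrow> ('m::finite \<Rightarrow> real ^ 'n ^ 'n) \<Rightarrow> ((real ^ 'm) \<times> (real ^ 'n ^ 'n)) set" where
  "dual_feasible C A = {(y, Z). Z \<in> psd_cone \<and> sdp_adj A y + Z = C}"

text \<open>
  The optimal values are real-valued infima and suprema, which are meaningful only if both
  problems are feasible (they are then finite by weak duality). This is the case whenever
  \<open>primal_solutions\<close> and \<open>dual_solutions\<close> are nonempty; on those sets the optimum is attained.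
\<close>

definition primal_value ::
    "real ^ 'n ^ 'n \<Rightarrow> ('m::finite \<Rightarrow> real ^ 'n ^ 'n) \<Rightarrow> real ^ 'm \<Rightarrow> real" where
  "primal_value C A b = (INF X\<in>primal_feasible A b. C \<bullet> X)"

definition dual_value ::
    "real ^ 'n ^ 'n \<Rightarrow> ('m::finite \<Rightarrow> real ^ 'n ^ 'n) \<Rightarrow> real ^ 'm \<Rightarrow> real" where
  "dual_value C A b = (SUP (y, Z)\<in>dual_feasible C A. b \<bullet> y)"

definition primal_solutions ::
    "real ^ 'n ^ 'n \<Rightarrow> ('m::finite \<Rightarrow> real ^ 'n ^ 'n) \<Rightarrow> real ^ 'm \<Rightarrow> (real ^ 'n ^ 'n) set" where
  "primal_solutions C A b = {X \<in> primal_feasible A b. C \<bullet> X = primal_value C A b}"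

definition dual_solutions ::
    "real ^ 'n ^ 'n \<Rightarrow> ('m::finite \<Rightarrow> real ^ 'n ^ 'n) \<Rightarrow> real ^ 'm
      \<Rightarrow> ((real ^ 'm) \<times> (real ^ 'n ^ 'n)) set" where
  "dual_solutions C A b = {(y, Z) \<in> dual_feasible C A. b \<bullet> y = dual_value C A b}"

definition strong_duality ::
    "real ^ 'n ^ 'n \<Rightarrow> ('m::finite \<Rightarrow> real ^ 'n ^ 'n) \<Rightarrow> real ^ 'm \<Rightarrow> bool" where
  "strong_duality C A b \<longleftrightarrow> primal_value C A b = dual_value C A b"

definition dual_strict_complementarity ::
    "real ^ 'n ^ 'n \<Rightarrow> ('m::finite \<Rightarrow> real ^ 'n ^ 'n) \<Rightarrow> real ^ 'm \<Rightarrow> bool" where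
  "dual_strict_complementarity C A b \<longleftrightarrow>
     (\<exists>X y Z. X \<in> primal_solutions C A b \<and> (y, Z) \<in> dual_solutions C A b \<and>
        X \<in> rel_interior (normal_cone (polar_cone psd_cone) (- Z)))"

definition aug_lagrangian ::
    "real ^ 'n ^ 'n \<Rightarrow> ('m::finite \<Rightarrow> real ^ 'n ^ 'n) \<Rightarrow> real ^ 'm \<Rightarrow> real
      \<Rightarrow> real ^ 'n ^ 'n \<Rightarrow> (real ^ 'm) \<times> (real ^ 'n ^ 'n) \<Rightarrow> real" where
  "aug_lagrangian C A b r X w = (case w of (y, Z) \<Rightarrow>
     C \<bullet> X + 1 / (2 * r) *
       ((norm (y + r *\<^sub>R (b - sdp_op A X)))\<^sup>2 + (norm (proj_psd (Z - r *\<^sub>R X)))\<^sup>2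
         - (norm y)\<^sup>2 - (norm Z)\<^sup>2))"

text \<open>
  Suboptimality of \<open>X\<close> in the subproblem. The infimum is the optimal value of the subproblem;
  for \<open>r > 0\<close> the objective is bounded below as soon as (D) is feasible.
\<close>

definition subproblem_gap ::
    "real ^ 'n ^ 'n \<Rightarrow> ('m::finite \<Rightarrow> real ^ 'n ^ 'n) \<Rightarrow> real ^ 'm \<Rightarrow> real
      \<Rightarrow> real ^ 'n ^ 'n \<Rightarrow> (real ^ 'm) \<times> (real ^ 'n ^ 'n) \<Rightarrow> real" where
  "subproblem_gap C A b r X w =
     aug_lagrangian C A b r X w - (INF X'\<in>sym_mats. aug_lagrangian C A b r X' w)"

definition alm_update ::
    "('m::finite \<Rightarrow> real ^ 'n ^ 'n) \<Rightarrow> real ^ 'm \<Rightarrow> real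
      \<Rightarrow> real ^ 'n ^ 'n \<Rightarrow> (real ^ 'm) \<times> (real ^ 'n ^ 'n) \<Rightarrow> (real ^ 'm) \<times> (real ^ 'n ^ 'n)" where
  "alm_update A b r X w = (case w of (y, Z) \<Rightarrow>
     (y + r *\<^sub>R (b - sdp_op A X), proj_psd (Z - r *\<^sub>R X)))"

text \<open>
  \<open>X 0\<close> plays no role. How accurately \<open>X (Suc k)\<close> minimizes the subproblem is the
  content of the two criteria below.
\<close>

definition alm_sequence ::
    "('m::finite \<Rightarrow> real ^ 'n ^ 'n) \<Rightarrow> real ^ 'm \<Rightarrow> (nat \<Rightarrow> real)
      \<Rightarrow> (nat \<Rightarrow> real ^ 'n ^ 'n) \<Rightarrow> (nat \<Rightarrow> (real ^ 'm) \<times> (real ^ 'n ^ 'n)) \<Rightarrow> bool" where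
  "alm_sequence A b r X w \<longleftrightarrow>
     snd (w 0) \<in> psd_cone \<and>
     (\<forall>k. X (Suc k) \<in> sym_mats \<and> w (Suc k) = alm_update A b (r k) (X (Suc k)) (w k))"

definition criterion_A ::
    "real ^ 'n ^ 'n \<Rightarrow> ('m::finite \<Rightarrow> real ^ 'n ^ 'n) \<Rightarrow> real ^ 'm \<Rightarrow> (nat \<Rightarrow> real)
      \<Rightarrow> (nat \<Rightarrow> real) \<Rightarrow> (nat \<Rightarrow> real ^ 'n ^ 'n) \<Rightarrow> (nat \<Rightarrow> (real ^ 'm) \<times> (real ^ 'n ^ 'n)) \<Rightarrow> bool" where
  "criterion_A C A b r \<epsilon> X w \<longleftrightarrow>
     (\<forall>k. 0 \<le> \<epsilon> k) \<and> summable \<epsilon> \<and>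
     (\<forall>k. subproblem_gap C A b (r k) (X (Suc k)) (w k) \<le> (\<epsilon> k)\<^sup>2 / (2 * r k))"

definition criterion_B ::
    "real ^ 'n ^ 'n \<Rightarrow> ('m::finite \<Rightarrow> real ^ 'n ^ 'n) \<Rightarrow> real ^ 'm \<Rightarrow> (nat \<Rightarrow> real)
      \<Rightarrow> (nat \<Rightarrow> real) \<Rightarrow> (nat \<Rightarrow> real ^ 'n ^ 'n) \<Rightarrow> (nat \<Rightarrow> (real ^ 'm) \<times> (real ^ 'n ^ 'n)) \<Rightarrow> bool" where
  "criterion_B C A b r \<delta> X w \<longleftrightarrow>
     (\<forall>k. 0 \<le> \<delta> k) \<and> summable \<delta> \<and>
     (\<forall>k. subproblem_gap C A b (r k) (X (Suc k)) (w k)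
            \<le> (\<delta> k)\<^sup>2 * (norm (w (Suc k) - w k))\<^sup>2 / (2 * r k))"

end

theory Submission
  imports Defs
begin

text \<open>
  The multiplier update of the augmented Lagrangian method is an inexact proximal point step for
  the dual problem. Maximizing over \<open>v = (y', Z')\<close> with \<open>Z'\<close> positive semidefinite writes
  the augmented Lagrangian as the maximum of the ordinary Lagrangian minus
  \<open>|v - w|^2 / (2 r)\<close>, and the maximizer is the updated multiplier. Strong concavity in
  \<open>v\<close>, together with the absence of a duality gap between the subproblem and the proximal
  problem (\<open>subproblem_no_gap\<close>), bounds the squared distance between the updated multiplier
  and the exact proximal point by \<open>2 r\<close> times the suboptimality of the subproblem
  (\<open>alm_update_near_prox\<close>). So criterion A makes the proximal errors summable, which keeps
  the multipliers bounded, and criterion B makes them a vanishing fraction of the step length.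

  A proximal point method contracts the distance to the solution set as soon as the objective
  grows quadratically away from that set. The growth comes from strict complementarity. Let
  \<open>P\<close> be the orthogonal projector onto the kernel of the optimal \<open>Z\<close>. Strict
  complementarity says that the optimal \<open>X\<close> dominates a positive multiple of \<open>P\<close>,
  while the optimal \<open>Z\<close> dominates a positive multiple of \<open>1 - P\<close>
  (\<open>strict_complementarity_projector\<close>). The suboptimality of a dual feasible point
  \<open>(y, Z')\<close> is the inner product of \<open>Z'\<close> with the optimal \<open>X\<close>, so it
  controls the inner product of \<open>Z'\<close> and \<open>P\<close>, and hence, up to a square root, the
  norm of \<open>Z' P\<close>. The dual solutions are exactly the dual feasible points with
  \<open>Z' P = 0\<close>. On the linear space cut out by this equation the optimal \<open>Z\<close> is
  an interior point of the semidefinite cone, so on bounded sets the distance to the solutions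
  is bounded by a multiple of the residual of the linear equations alone
  (\<open>face_error_bound\<close>). This gives \<open>dual_quadratic_growth\<close>, and with it the linear rate.

  The feasibility residuals of the new primal iterate are bounded by the multiplier step divided by
  \<open>r\<close> (\<open>alm_residuals\<close>), and its excess in the objective by the change of the squared
  multiplier norm and the subproblem error (\<open>alm_value_bound\<close>). The step is eventually at most
  twice the distance of the old multiplier to the dual solutions. For the distance of the primal
  iterate to the primal solutions, the same error bound is applied with \<open>1 - P\<close> in place of \<open>P\<close> (\<open>primal_error_bound\<close>). Here
  boundedness of the primal solution set is what keeps all points with small residuals in a bounded
  set, and the square root in the argument is the reason for the squared distance in the
  conclusion.
\<close>

section \<open>Positive semidefinite matrices\<close>

definition outer :: "real ^ 'n \<Rightarrow> real ^ 'm \<Rightarrow> real ^ 'm ^ 'n" where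
  "outer u v = (\<chi> i j. u $ i * v $ j)"

lemma inner_outer: "X \<bullet> outer u v = u \<bullet> (X *v v)"
  by (simp add: inner_vec_def outer_def matrix_vector_mult_def sum_distrib_left mult_ac)

lemma outer_vec: "outer u v *v x = (v \<bullet> x) *\<^sub>R u"
  by (simp add: vec_eq_iff inner_vec_def outer_def matrix_vector_mult_def sum_distrib_left
      sum_distrib_right mult_ac)

lemma norm_outer: "norm (outer u v) = norm u * norm v"
proof -
  have "(norm (outer u v))\<^sup>2 = (norm u * norm v)\<^sup>2"
    by (simp add: power2_norm_eq_inner inner_outer outer_vec power_mult_distrib)
  then show ?thesis by (simp add: power2_eq_iff_nonneg)
qed

lemma quad_form_le_norm: "v \<bullet> (X *v v) \<le> norm X * (norm (v :: real ^ 'n))\<^sup>2"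
  using norm_cauchy_schwarz[of X "outer v v"]
  by (simp add: inner_outer norm_outer power2_eq_square)

lemma inner_mult_left:
  fixes X :: "real ^ 'k ^ 'n" and Y :: "real ^ 'm ^ 'k" and Z :: "real ^ 'm ^ 'n"
  shows "(X ** Y) \<bullet> Z = Y \<bullet> (transpose X ** Z)"
proof -
  have "(X ** Y) \<bullet> Z = (\<Sum>i\<in>UNIV. \<Sum>j\<in>UNIV. \<Sum>k\<in>UNIV. X $ i $ k * Y $ k $ j * Z $ i $ j)"
    by (simp add: inner_vec_def matrix_matrix_mult_def sum_distrib_right)
  also have "\<dots> = (\<Sum>i\<in>UNIV. \<Sum>k\<in>UNIV. \<Sum>j\<in>UNIV. X $ i $ k * Y $ k $ j * Z $ i $ j)"
    by (rule sum.cong[OF refl], rule sum.swap)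
  also have "\<dots> = (\<Sum>k\<in>UNIV. \<Sum>i\<in>UNIV. \<Sum>j\<in>UNIV. X $ i $ k * Y $ k $ j * Z $ i $ j)"
    by (rule sum.swap)
  also have "\<dots> = (\<Sum>k\<in>UNIV. \<Sum>j\<in>UNIV. \<Sum>i\<in>UNIV. X $ i $ k * Y $ k $ j * Z $ i $ j)"
    by (rule sum.cong[OF refl], rule sum.swap)
  also have "\<dots> = Y \<bullet> (transpose X ** Z)"
    by (simp add: inner_vec_def matrix_matrix_mult_def transpose_def sum_distrib_left mult_ac)
  finally show ?thesis .
qed

lemma inner_transpose: "transpose X \<bullet> transpose Y = X \<bullet> (Y :: real ^ 'n ^ 'm)"
  unfolding inner_vec_def transpose_def by (simp, rule sum.swap)

lemma inner_mult_right:
  fixes X :: "real ^ 'k ^ 'n" and Y :: "real ^ 'm ^ 'k" and Z :: "real ^ 'm ^ 'n"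
  shows "(X ** Y) \<bullet> Z = X \<bullet> (Z ** transpose Y)"
proof -
  have "(X ** Y) \<bullet> Z = (transpose Y ** transpose X) \<bullet> transpose Z"
    by (simp only: inner_transpose flip: matrix_transpose_mul)
  also have "\<dots> = transpose X \<bullet> (Y ** transpose Z)"
    by (simp only: inner_mult_left transpose_transpose)
  also have "\<dots> = X \<bullet> (Z ** transpose Y)"
    by (simp only: inner_transpose[of X, symmetric] matrix_transpose_mul transpose_transpose)
  finally show ?thesis .
qed

lemma linear_matrix_mult_left: "linear (\<lambda>X :: real ^ 'k ^ 'n. X ** (R :: real ^ 'm ^ 'k))"
  by (rule linearI)
    (simp_all add: vec_eq_iff matrix_matrix_mult_def sum.distrib sum_distrib_left algebra_simps)

lemmas mult_add_left = linear_add[OF linear_matrix_mult_left]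
  and mult_diff_left = linear_diff[OF linear_matrix_mult_left]
  and mult_scale_left = linear_scale[OF linear_matrix_mult_left]

lemma transpose_add: "transpose (X + Y) = transpose X + transpose Y"
  and transpose_diff: "transpose (X - Y) = transpose X - transpose (Y :: real ^ 'n ^ 'm)"
  by (simp_all add: vec_eq_iff transpose_def)

lemma subspace_sym_mats: "subspace sym_mats"
  by (auto simp: subspace_def sym_mats_def transpose_add transpose_scalar)
    (simp add: transpose_def vec_eq_iff)

lemma outer_sym: "outer u u \<in> sym_mats"
  by (simp add: sym_mats_def outer_def transpose_def vec_eq_iff mult.commute)

lemma sym_mats_inner: "X \<in> sym_mats \<Longrightarrow> u \<bullet> (X *v v) = (X *v u) \<bullet> v"
  by (simp add: sym_mats_def flip: dot_lmul_matrix transpose_matrix_vector)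

lemma psd_sym: "X \<in> psd_cone \<Longrightarrow> X \<in> sym_mats"
  and psd_quad: "X \<in> psd_cone \<Longrightarrow> 0 \<le> v \<bullet> (X *v v)"
  by (auto simp: psd_cone_def)

lemma outer_psd: "outer u u \<in> psd_cone"
  by (simp add: psd_cone_def outer_sym outer_vec inner_commute)

lemma zero_psd: "0 \<in> psd_cone"
  by (simp add: psd_cone_def subspace_0 subspace_sym_mats)

lemma psd_add: "X \<in> psd_cone \<Longrightarrow> Y \<in> psd_cone \<Longrightarrow> X + Y \<in> psd_cone"
  by (simp add: psd_cone_def subspace_add subspace_sym_mats matrix_vector_mult_add_rdistrib
      inner_add_right)

lemma psd_scale: "X \<in> psd_cone \<Longrightarrow> 0 \<le> c \<Longrightarrow> c *\<^sub>R X \<in> psd_cone"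
  by (simp add: psd_cone_def subspace_mul subspace_sym_mats flip: scaleR_matrix_vector_assoc)

lemma convex_psd: "convex psd_cone"
  by (simp add: convex_def psd_add psd_scale)

lemma closed_psd: "closed psd_cone"
proof -
  have "psd_cone = sym_mats \<inter> (\<Inter>v. {X. X \<bullet> outer v v \<ge> (0::real)})"
    by (auto simp: psd_cone_def inner_outer)
  also have "closed \<dots>"
    by (intro closed_Int closed_INT ballI closed_Collect_le continuous_intros closed_subspace
        subspace_sym_mats)
  finally show ?thesis .
qed

lemma psd_cauchy_schwarz:
  assumes "X \<in> psd_cone"
  shows "(u \<bullet> (X *v v))\<^sup>2 \<le> (u \<bullet> (X *v u)) * (v \<bullet> (X *v v))"
proof -
  let ?a = "u \<bullet> (X *v u)" and ?b = "u \<bullet> (X *v v)" and ?c = "v \<bullet> (X *v v)"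
  have sym: "v \<bullet> (X *v u) = ?b"
    using sym_mats_inner[OF psd_sym[OF assms], of u v] by (simp add: inner_commute)
  have q: "0 \<le> s\<^sup>2 * ?a + 2 * s * t * ?b + t\<^sup>2 * ?c" for s t
    using psd_quad[OF assms, of "s *\<^sub>R u + t *\<^sub>R v"] sym
    by (simp add: matrix_vector_right_distrib matrix_vector_mult_scaleR inner_add_left
        inner_add_right power2_eq_square algebra_simps)
  have a: "0 \<le> ?a" and c: "0 \<le> ?c" using psd_quad[OF assms] by auto
  show ?thesis
  proof (cases "?c = 0")
    case True
    have "?b = 0"
    proof (rule ccontr)
      assume "?b \<noteq> 0"
      then show False using q[of 1 "-(?a + 1) / (2 * ?b)"] True by (simp add: field_simps)
    qed
    then show ?thesis using True by simp
  next
    case False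
    with c have "0 < ?c" by simp
    from q[of "?c" "- ?b"] have "0 \<le> ?c * (?c * ?a - ?b\<^sup>2)"
      by (simp add: power2_eq_square algebra_simps)
    with \<open>0 < ?c\<close> show ?thesis by (simp add: zero_le_mult_iff mult.commute)
  qed
qed

lemma psd_norm_vec_le:
  assumes "X \<in> psd_cone"
  shows "(norm (X *v v))\<^sup>2 \<le> norm X * (v \<bullet> (X *v v))"
proof (cases "X *v v = 0")
  case False
  let ?u = "X *v v"
  have "((norm ?u)\<^sup>2)\<^sup>2 \<le> (?u \<bullet> (X *v ?u)) * (v \<bullet> (X *v v))"
    using psd_cauchy_schwarz[OF assms, of ?u v] by (simp add: power2_norm_eq_inner)
  also have "\<dots> \<le> (norm X * (norm ?u)\<^sup>2) * (v \<bullet> (X *v v))"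
    by (intro mult_right_mono quad_form_le_norm psd_quad assms)
  finally have "(norm ?u)\<^sup>2 * (norm ?u)\<^sup>2 \<le> (norm ?u)\<^sup>2 * (norm X * (v \<bullet> (X *v v)))"
    by (simp add: power2_eq_square mult_ac)
  moreover have "0 < (norm ?u)\<^sup>2" using False by simp
  ultimately show ?thesis by (simp only: mult_le_cancel_left_pos)
qed (simp add: psd_quad assms)

text \<open>
  Self-duality of the cone. One Cholesky step subtracts from \<open>X\<close> the rank-one matrix built
  from a nonzero column: by the Cauchy-Schwarz inequality for the form of \<open>X\<close> the
  remainder is again positive semidefinite, and it has fewer nonzero columns. On a rank-one matrix
  the inner product is a value of the quadratic form of \<open>Y\<close>.
\<close>

lemma psd_inner_nonneg:
  fixes X Y :: "real ^ 'n ^ 'n"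
  assumes "X \<in> psd_cone" "Y \<in> psd_cone"
  shows "0 \<le> X \<bullet> Y"
  using assms(1)
proof (induction "card {i. X *v axis i 1 \<noteq> 0}" arbitrary: X rule: less_induct)
  case less
  show ?case
  proof (cases "X = 0")
    case False
    obtain i where i: "X *v axis i 1 \<noteq> 0"
    proof (rule ccontr)
      assume "\<not> thesis"
      with that have "X *v axis i 1 = 0" for i by blast
      then have "column i X = 0" for i by (simp add: matrix_vector_mult_basis)
      then have "X = 0" by (simp add: vec_eq_iff column_def)
      with False show False by simp
    qed
    define u where "u = X *v axis i 1"
    define c where "c = axis i 1 \<bullet> u"
    have "0 < norm X" using False by simp
    moreover have "0 < (norm u)\<^sup>2" using i u_def by simp
    moreover have "(norm u)\<^sup>2 \<le> norm X * c"
      unfolding u_def c_def by (rule psd_norm_vec_le[OF less.prems])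
    ultimately have c: "0 < c" by (metis order_less_le_trans zero_less_mult_pos)
    define X' where "X' = X - (1 / c) *\<^sub>R outer u u"
    have X'v: "X' *v v = X *v v - ((u \<bullet> v) / c) *\<^sub>R u" for v
      by (simp add: X'_def matrix_vector_mult_diff_rdistrib outer_vec flip: scaleR_matrix_vector_assoc)
    have uv: "u \<bullet> v = v \<bullet> (X *v axis i 1)" for v
      by (simp add: u_def inner_commute)
    have uv': "u \<bullet> v = axis i 1 \<bullet> (X *v v)" for v
      using sym_mats_inner[OF psd_sym[OF less.prems], of "axis i 1" v] by (simp add: u_def)
    have psd: "X' \<in> psd_cone"
    proof -
      have "0 \<le> v \<bullet> (X' *v v)" for v
      proof -
        have "(u \<bullet> v)\<^sup>2 \<le> (v \<bullet> (X *v v)) * c"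
          using psd_cauchy_schwarz[OF less.prems, of v "axis i 1"]
          unfolding uv unfolding c_def u_def .
        then have "(u \<bullet> v)\<^sup>2 / c \<le> v \<bullet> (X *v v)" using c by (simp add: divide_simps)
        then show ?thesis
          by (simp add: X'v inner_diff_right inner_commute power2_eq_square)
      qed
      moreover have "X' \<in> sym_mats" unfolding X'_def
        by (intro subspace_diff subspace_mul subspace_sym_mats psd_sym[OF less.prems] outer_sym)
      ultimately show ?thesis by (simp add: psd_cone_def)
    qed
    have "{j. X' *v axis j 1 \<noteq> 0} \<subset> {j. X *v axis j 1 \<noteq> 0}"
    proof
      show "{j. X' *v axis j 1 \<noteq> 0} \<subseteq> {j. X *v axis j 1 \<noteq> 0}"
        by (auto simp: X'v uv')
      have "X' *v axis i 1 = 0"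
        using c by (simp add: X'v c_def inner_commute flip: u_def)
      then show "{j. X' *v axis j 1 \<noteq> 0} \<noteq> {j. X *v axis j 1 \<noteq> 0}" using i by blast
    qed
    then have "0 \<le> X' \<bullet> Y" by (intro less.hyps psd psubset_card_mono) auto
    moreover have "0 \<le> outer u u \<bullet> Y"
      using psd_quad[OF assms(2), of u] by (simp add: inner_commute[of "outer u u"] inner_outer)
    moreover have "X \<bullet> Y = X' \<bullet> Y + (1 / c) * (outer u u \<bullet> Y)"
      by (simp add: X'_def inner_diff_left)
    ultimately show ?thesis using c by simp
  qed simp
qed

lemma psd_iff_inner_nonneg:
  "X \<in> psd_cone \<longleftrightarrow> X \<in> sym_mats \<and> (\<forall>Y\<in>psd_cone. 0 \<le> X \<bullet> Y)"
proof
  assume "X \<in> sym_mats \<and> (\<forall>Y\<in>psd_cone. 0 \<le> X \<bullet> Y)"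
  then have "0 \<le> v \<bullet> (X *v v)" for v
    using outer_psd[of v] inner_outer[of X v v] by metis
  with \<open>X \<in> sym_mats \<and> _\<close> show "X \<in> psd_cone" by (simp add: psd_cone_def)
qed (simp add: psd_inner_nonneg psd_sym)

text \<open>
  This turns a bound on an inner product into a bound on a product of matrices, at the cost of a
  square root; it is the source of all square roots below. The matrix
  \<open>|Z| Z - Z Z\<close> is positive semidefinite, and pairing it with \<open>R = R R\<close> gives the
  claim.
\<close>

lemma norm_mult_projector_le:
  fixes Z R :: "real ^ 'n ^ 'n"
  assumes "Z \<in> psd_cone" "R \<in> psd_cone" "R ** R = R"
  shows "(norm (Z ** R))\<^sup>2 \<le> norm Z * (Z \<bullet> R)"
proof -
  have Zt: "transpose Z = Z" and Rt: "transpose R = R"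
    using psd_sym assms by (auto simp: sym_mats_def)
  have "norm Z *\<^sub>R Z - Z ** Z \<in> psd_cone"
  proof -
    have "v \<bullet> ((Z ** Z) *v v) = (norm (Z *v v))\<^sup>2" for v
      using sym_mats_inner[OF psd_sym[OF assms(1)], of v "Z *v v"]
      by (simp add: power2_norm_eq_inner flip: matrix_vector_mul_assoc)
    then have "0 \<le> v \<bullet> ((norm Z *\<^sub>R Z - Z ** Z) *v v)" for v
      using psd_norm_vec_le[OF assms(1), of v]
      by (simp add: matrix_vector_mult_diff_rdistrib inner_diff_right flip: scaleR_matrix_vector_assoc)
    moreover have "norm Z *\<^sub>R Z - Z ** Z \<in> sym_mats"
      by (simp add: sym_mats_def transpose_diff transpose_scalar matrix_transpose_mul Zt)
    ultimately show ?thesis by (simp add: psd_cone_def)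
  qed
  then have "0 \<le> (norm Z *\<^sub>R Z - Z ** Z) \<bullet> R" by (rule psd_inner_nonneg[OF _ assms(2)])
  moreover have "(Z ** Z) \<bullet> R = (norm (Z ** R))\<^sup>2"
  proof -
    have "(Z ** R) \<bullet> (Z ** R) = Z \<bullet> (Z ** R ** R)"
      by (simp add: inner_mult_right Rt)
    also have "\<dots> = Z \<bullet> (Z ** R)" by (simp add: assms(3) flip: matrix_mul_assoc)
    also have "\<dots> = (Z ** Z) \<bullet> R" by (simp add: inner_mult_left Zt)
    finally show ?thesis by (simp add: power2_norm_eq_inner)
  qed
  ultimately show ?thesis by (simp add: inner_diff_left)
qed

lemma projector_psd:
  assumes "R \<in> sym_mats" "R ** R = R"
  shows "R \<in> psd_cone"
proof -
  have "v \<bullet> (R *v v) = (norm (R *v v))\<^sup>2" for v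
    using sym_mats_inner[OF assms(1), of v "R *v v"] assms(2)
    by (simp add: power2_norm_eq_inner matrix_vector_mul_assoc)
  then show ?thesis using assms(1) by (simp add: psd_cone_def)
qed

lemma complement_projector:
  fixes R :: "real ^ 'n ^ 'n"
  assumes "R \<in> sym_mats" "R ** R = R"
  shows "mat 1 - R \<in> sym_mats" "(mat 1 - R) ** (mat 1 - R) = mat 1 - R" "mat 1 - R \<in> psd_cone"
proof -
  show 1: "mat 1 - R \<in> sym_mats"
    using assms by (simp add: sym_mats_def transpose_diff)
  have "R *v (R *v v) = R *v v" for v by (simp add: assms matrix_vector_mul_assoc)
  then have "(mat 1 - R) *v ((mat 1 - R) *v v) = (mat 1 - R) *v v" for v
    by (simp add: matrix_vector_mult_diff_rdistrib matrix_vector_mult_diff_distrib)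
  then show 2: "(mat 1 - R) ** (mat 1 - R) = mat 1 - R"
    by (simp add: matrix_eq flip: matrix_vector_mul_assoc)
  show "mat 1 - R \<in> psd_cone" by (rule projector_psd[OF 1 2])
qed

text \<open>
  \<open>P\<close> is the sum of the rank-one matrices of an orthonormal basis of the kernel. On the
  orthogonal complement \<open>Z\<close> is injective, so \<open>|Z v|\<close> is at least a multiple of
  \<open>|v|\<close>, and the Cauchy-Schwarz inequality of the form of \<open>Z\<close> passes this on to
  the form itself.
\<close>

lemma kernel_projector:
  fixes Z :: "real ^ 'n ^ 'n"
  assumes "Z \<in> psd_cone"
  obtains P \<kappa> where "P \<in> sym_mats" "P ** P = P" "Z ** P = 0" "0 < \<kappa>"
    "Z - \<kappa> *\<^sub>R (mat 1 - P) \<in> psd_cone"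
proof -
  define L where "L = {v. Z *v v = 0}"
  have L: "subspace L"
    by (auto simp: L_def subspace_def matrix_vector_right_distrib matrix_vector_mult_scaleR)
  obtain B where B: "B \<subseteq> L" "pairwise orthogonal B" "\<And>x. x \<in> B \<Longrightarrow> norm x = 1"
      "independent B" "span B = L"
    using orthonormal_basis_subspace[OF L] by metis
  have fin: "finite B" using B(4) independent_imp_finite by blast
  define P where "P = (\<Sum>b\<in>B. outer b b)"
  have Pv: "P *v v = (\<Sum>b\<in>B. (b \<bullet> v) *\<^sub>R b)" for v
    unfolding P_def using fin
    by (induction B rule: finite_induct)
      (simp_all add: matrix_vector_mult_add_rdistrib outer_vec)
  have PL: "P *v v \<in> L" for v
    unfolding Pv B(5)[symmetric] by (intro span_sum span_scale span_base)
  have sym: "P \<in> sym_mats"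
    unfolding P_def by (intro subspace_sum subspace_sym_mats outer_sym)
  have orth: "x \<bullet> (v - P *v v) = 0" if "x \<in> L" for x v
  proof -
    have b: "b \<bullet> (v - P *v v) = 0" if "b \<in> B" for b
    proof -
      have "b \<bullet> (P *v v) = (\<Sum>c\<in>B. (c \<bullet> v) * (b \<bullet> c))"
        by (simp add: Pv inner_sum_right)
      also have "\<dots> = (\<Sum>c\<in>B. if c = b then b \<bullet> v else 0)"
        using B(2) B(3)[OF that] that
        by (intro sum.cong) (auto simp: pairwise_def orthogonal_def norm_eq_1)
      also have "\<dots> = b \<bullet> v" using fin that by simp
      finally show ?thesis by (simp add: inner_diff_right)
    qed
    from that have "x \<in> span B" by (simp add: B(5))
    then show ?thesis
      by (rule span_induct) (auto simp: subspace_def inner_add_left b)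
  qed
  have idem: "P ** P = P"
  proof -
    have "P *v (P *v v) = P *v v" for v
    proof -
      let ?d = "P *v v - P *v (P *v v)"
      have "?d \<in> L" by (intro subspace_diff L PL)
      then have "?d \<bullet> ?d = 0" by (rule orth)
      then show ?thesis by simp
    qed
    then show ?thesis by (simp add: matrix_eq flip: matrix_vector_mul_assoc)
  qed
  have ZP: "Z ** P = 0"
    using PL by (simp add: matrix_eq L_def flip: matrix_vector_mul_assoc)
  have "bounded_linear ((*v) Z)" by (simp add: linear_conv_bounded_linear[symmetric])
  moreover have "\<forall>x\<in>orthogonal_comp L. Z *v x = 0 \<longrightarrow> x = 0"
    by (auto simp: orthogonal_comp_def L_def orthogonal_def)
  ultimately obtain e where e: "0 < e"
      "\<And>x. x \<in> orthogonal_comp L \<Longrightarrow> norm (Z *v x) \<ge> e * norm x"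
    using injective_imp_isometric[of "orthogonal_comp L" "(*v) Z"]
    by (meson closed_subspace subspace_orthogonal_comp)
  define \<kappa> where "\<kappa> = e\<^sup>2 / (norm Z + 1)"
  have pos: "0 < \<kappa>" using e(1) by (simp add: \<kappa>_def add_nonneg_pos)
  have psd: "Z - \<kappa> *\<^sub>R (mat 1 - P) \<in> psd_cone"
  proof -
    have "0 \<le> v \<bullet> ((Z - \<kappa> *\<^sub>R (mat 1 - P)) *v v)" for v
    proof -
      let ?u = "v - P *v v"
      have u: "?u \<in> orthogonal_comp L"
        using orth by (simp add: orthogonal_comp_def orthogonal_def)
      have Zu: "Z *v ?u = Z *v v"
        using PL[of v] by (simp add: L_def matrix_vector_mult_diff_distrib)
      have "(e * norm ?u)\<^sup>2 \<le> (norm (Z *v v))\<^sup>2"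
        using e(2)[OF u] e(1) unfolding Zu by (intro power_mono) auto
      also have "\<dots> \<le> norm Z * (v \<bullet> (Z *v v))" by (rule psd_norm_vec_le[OF assms])
      also have "\<dots> \<le> (norm Z + 1) * (v \<bullet> (Z *v v))"
        by (intro mult_right_mono psd_quad assms) simp
      finally have "\<kappa> * (norm ?u)\<^sup>2 \<le> v \<bullet> (Z *v v)"
        by (simp add: \<kappa>_def power_mult_distrib divide_simps add_nonneg_pos mult.commute
            split: if_splits)
      moreover have "(norm ?u)\<^sup>2 = v \<bullet> ((mat 1 - P) *v v)"
        using orth[OF PL, of v v]
        by (simp add: power2_norm_eq_inner matrix_vector_mult_diff_rdistrib inner_diff_left)
      ultimately show ?thesis
        by (simp add: matrix_vector_mult_diff_rdistrib[of Z] inner_diff_right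
            flip: scaleR_matrix_vector_assoc)
    qed
    moreover have "Z - \<kappa> *\<^sub>R (mat 1 - P) \<in> sym_mats"
      by (intro subspace_diff subspace_mul subspace_sym_mats psd_sym assms
          complement_projector sym idem)
    ultimately show ?thesis by (simp add: psd_cone_def)
  qed
  show thesis by (rule that[OF sym idem ZP pos psd])
qed

section \<open>Projection onto the semidefinite cone\<close>

lemma proj_psd_in: "proj_psd a \<in> psd_cone"
proof -
  have "psd_cone \<noteq> {}" using zero_psd by (metis empty_iff)
  then show ?thesis unfolding proj_psd_def by (rule closest_point_in_set[OF closed_psd])
qed

lemma proj_psd_polar:
  assumes "Y \<in> psd_cone"
  shows "0 \<le> (proj_psd a - a) \<bullet> Y"
  using closest_point_dot[OF convex_psd closed_psd psd_add[OF proj_psd_in assms], of a a]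
  by (simp add: inner_diff_left flip: proj_psd_def)

lemma proj_psd_orthogonal: "(proj_psd a - a) \<bullet> proj_psd a = 0"
proof -
  have "(a - proj_psd a) \<bullet> (0 - proj_psd a) \<le> 0"
    unfolding proj_psd_def by (rule closest_point_dot[OF convex_psd closed_psd zero_psd])
  with proj_psd_polar[OF proj_psd_in, of a a] show ?thesis
    by (simp add: inner_diff_left)
qed

lemma proj_psd_diff_psd: "a \<in> sym_mats \<Longrightarrow> proj_psd a - a \<in> psd_cone"
  unfolding psd_iff_inner_nonneg[of "proj_psd a - a"]
  by (simp add: proj_psd_polar subspace_diff subspace_sym_mats psd_sym proj_psd_in)

section \<open>Error bound for faces of the semidefinite cone\<close>

text \<open>
  Hoffman's bound for linear equations: on the orthogonal complement of the kernel the linear map is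
  bounded below.
\<close>

lemma linear_error_bound:
  fixes f :: "'a::euclidean_space \<Rightarrow> 'b::euclidean_space"
  assumes f: "linear f" and W: "subspace W"
  obtains \<kappa> where "0 < \<kappa>"
    "\<And>x. x \<in> W \<Longrightarrow> \<exists>u\<in>W. f u = 0 \<and> norm (x - u) \<le> \<kappa> * norm (f x)"
proof -
  define N where "N = {x \<in> W. f x = 0}"
  have N: "subspace N"
    using W f by (auto simp: N_def subspace_def linear_0 linear_add linear_scale)
  let ?D = "W \<inter> orthogonal_comp N"
  have D: "subspace ?D" by (intro subspace_inter W subspace_orthogonal_comp)
  have "\<forall>x\<in>?D. f x = 0 \<longrightarrow> x = 0"
    by (auto simp: orthogonal_comp_def N_def orthogonal_def)
  then obtain e where e: "0 < e" "\<And>x. x \<in> ?D \<Longrightarrow> norm (f x) \<ge> e * norm x"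
    using injective_imp_isometric[OF closed_subspace[OF D] D, of f] f
    by (auto simp: linear_conv_bounded_linear)
  have "\<exists>u\<in>W. f u = 0 \<and> norm (x - u) \<le> (1 / e) * norm (f x)" if x: "x \<in> W" for x
  proof -
    obtain u z where u: "u \<in> span N" and z: "\<And>v. v \<in> span N \<Longrightarrow> orthogonal z v"
      and xuz: "x = u + z"
      using orthogonal_subspace_decomp_exists[of N x] by metis
    have uN: "u \<in> N" using u N by (simp add: span_eq_iff[THEN iffD2])
    then have "u \<in> W" and fu: "f u = 0" by (auto simp: N_def)
    have "z = x - u" using xuz by simp
    then have "z \<in> W" using x \<open>u \<in> W\<close> W by (simp add: subspace_diff)
    moreover have "z \<in> orthogonal_comp N"
      using z by (auto simp: orthogonal_comp_def span_base orthogonal_commute)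
    ultimately have "e * norm z \<le> norm (f z)" using e(2) by blast
    moreover have "f z = f x" using fu f xuz by (simp add: linear_add)
    ultimately have "norm (x - u) \<le> (1 / e) * norm (f x)"
      using e(1) \<open>z = x - u\<close> by (simp add: field_simps)
    with \<open>u \<in> W\<close> fu show ?thesis by blast
  qed
  with e(1) show thesis by (intro that[of "1 / e"]) auto
qed

text \<open>
  The equations \<open>T u = T x0\<close> and \<open>M u R = 0\<close> are linear, so \<open>x\<close> is
  close to a point \<open>x'\<close> of \<open>W\<close> that satisfies them. The matrix
  \<open>M x'\<close> vanishes on the range of \<open>R\<close> and differs little from the positive
  semidefinite \<open>M x\<close>; hence it is bounded below by a small negative multiple of
  \<open>1 - R\<close>. As \<open>M x0\<close> dominates a positive multiple of \<open>1 - R\<close>,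
  moving from \<open>x'\<close> slightly towards \<open>x0\<close> repairs this, and the linear equations
  survive because \<open>x0\<close> satisfies them too. The map \<open>M\<close> allows one statement for
  dual pairs, where it is the second projection, and for primal matrices, where it is the identity.
\<close>

lemma face_error_bound:
  fixes T :: "'a::euclidean_space \<Rightarrow> 'b::euclidean_space" and M :: "'a \<Rightarrow> real ^ 'n ^ 'n"
  assumes T: "linear T" and M: "linear M" and W: "subspace W"
    and Msym: "\<And>x. x \<in> W \<Longrightarrow> M x \<in> sym_mats"
    and R: "R \<in> sym_mats" "R ** R = R"
    and x0: "x0 \<in> W" "M x0 ** R = 0"
    and l: "0 < l" "M x0 - l *\<^sub>R (mat 1 - R) \<in> psd_cone"
  obtains \<kappa> where "0 < \<kappa>"
    "\<And>x. x \<in> W \<Longrightarrow> M x \<in> psd_cone \<Longrightarrow>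
       \<exists>u\<in>W. T u = T x0 \<and> M u \<in> psd_cone \<and> M u ** R = 0 \<and>
         norm (x - u) \<le> \<kappa> * (norm (T x - T x0) + norm (M x ** R)) * (1 + norm (x - x0))"
proof -
  let ?S = "mat 1 - R"
  have S: "?S \<in> sym_mats" "?S ** ?S = ?S" "?S \<in> psd_cone"
    using complement_projector[OF R] by auto
  define f where "f x = (T x, M x ** R)" for x
  have f: "linear f"
    unfolding f_def
    by (rule linearI)
      (simp_all add: linear_add[OF T] linear_add[OF M] linear_scale[OF T] linear_scale[OF M]
        mult_add_left mult_scale_left)
  obtain \<kappa> where k: "0 < \<kappa>"
    "\<And>x. x \<in> W \<Longrightarrow> \<exists>u\<in>W. f u = 0 \<and> norm (x - u) \<le> \<kappa> * norm (f x)"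
    using linear_error_bound[OF f W] by metis
  obtain K where K: "0 < K" "\<And>x. norm (M x) \<le> K * norm x"
    using linear_bounded_pos[OF M] by metis
  show thesis
  proof (rule that[of "\<kappa> * (2 + K / l)"])
    show "0 < \<kappa> * (2 + K / l)" using k(1) K(1) l(1) by (simp add: add_pos_pos)
  next
    fix x assume x: "x \<in> W" "M x \<in> psd_cone"
    define e where "e = norm (T x - T x0) + norm (M x ** R)"
    define s where "s = \<kappa> * e"
    have s0: "0 \<le> s" using k(1) by (simp add: s_def e_def)
    have "f (x - x0) = (T x - T x0, M x ** R)"
      using x0(2) by (simp add: f_def linear_diff[OF T] linear_diff[OF M] mult_diff_left)
    then have fe: "norm (f (x - x0)) \<le> e"
      using norm_Pair_le[of "T x - T x0" "M x ** R"] by (simp add: e_def)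
    obtain v where v: "v \<in> W" "f v = 0" "norm (x - x0 - v) \<le> \<kappa> * norm (f (x - x0))"
      using k(2)[OF subspace_diff[OF W x(1) x0(1)]] by blast
    have vs: "norm (x - x0 - v) \<le> s"
      using order_trans[OF v(3) mult_left_mono[OF fe, of \<kappa>]] k(1) by (simp add: s_def)
    define x' where "x' = x0 + v"
    have x'W: "x' \<in> W" using W x0(1) v(1) by (simp add: x'_def subspace_add)
    have Tx': "T x' = T x0" and x'R: "M x' ** R = 0"
      using v(2) x0(2)
      by (simp_all add: x'_def f_def prod_eq_iff linear_add[OF T] linear_add[OF M] mult_add_left)
    have xx': "norm (x - x') \<le> s" using vs by (simp add: x'_def algebra_simps)
    \<comment> \<open>Only the component of a vector outside the range of \<open>R\<close> matters for \<open>M x'\<close>; there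
        \<open>M x'\<close> is \<open>M x\<close> up to an error of norm at most \<open>K s\<close>.\<close>
    have almost: "M x' + (K * s) *\<^sub>R ?S \<in> psd_cone"
    proof -
      have "0 \<le> v \<bullet> ((M x' + (K * s) *\<^sub>R ?S) *v v)" for v
      proof -
        let ?y = "?S *v v"
        have "M x' *v (R *v v) = 0" by (simp add: matrix_vector_mul_assoc x'R)
        then have "M x' *v ?y = M x' *v v"
          by (simp add: matrix_vector_mult_diff_rdistrib matrix_vector_mult_diff_distrib)
        then have 1: "v \<bullet> (M x' *v v) = ?y \<bullet> (M x' *v ?y)"
          using sym_mats_inner[OF Msym[OF x'W], of v ?y] by (simp add: inner_commute)
        have "v \<bullet> (?S *v v) = ?y \<bullet> ?y"
          using sym_mats_inner[OF S(1), of v ?y] by (simp add: matrix_vector_mul_assoc S(2))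
        then have 2: "v \<bullet> (?S *v v) = (norm ?y)\<^sup>2" by (simp add: power2_norm_eq_inner)
        have "M (x - x') = M x - M x'" by (rule linear_diff[OF M])
        then have "?y \<bullet> (M x *v ?y) - ?y \<bullet> (M x' *v ?y) \<le> norm (M (x - x')) * (norm ?y)\<^sup>2"
          using quad_form_le_norm[of ?y "M (x - x')"]
          by (simp only: matrix_vector_mult_diff_rdistrib inner_diff_right)
        also have "norm (M (x - x')) \<le> K * s"
          using order_trans[OF K(2)[of "x - x'"] mult_left_mono[OF xx', of K]] K(1) by simp
        then have "norm (M (x - x')) * (norm ?y)\<^sup>2 \<le> K * s * (norm ?y)\<^sup>2"
          by (intro mult_right_mono) auto
        finally have "0 \<le> ?y \<bullet> (M x' *v ?y) + K * s * (norm ?y)\<^sup>2"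
          using psd_quad[OF x(2), of ?y] by linarith
        moreover have "v \<bullet> ((M x' + (K * s) *\<^sub>R ?S) *v v)
            = v \<bullet> (M x' *v v) + K * s * (v \<bullet> (?S *v v))"
          by (simp only: matrix_vector_mult_add_rdistrib inner_add_right
              scaleR_matrix_vector_assoc[symmetric] inner_scaleR_right)
        ultimately show ?thesis by (simp only: 1 2)
      qed
      moreover have "M x' + (K * s) *\<^sub>R ?S \<in> sym_mats"
        by (intro subspace_add subspace_mul subspace_sym_mats Msym x'W S(1))
      ultimately show ?thesis by (simp add: psd_cone_def)
    qed
    \<comment> \<open>This weight of \<open>x0\<close> makes \<open>t l\<close> equal to the deficit \<open>K s\<close>.\<close>
    define t where "t = K * s / l"
    have t0: "0 \<le> t" using K(1) s0 l(1) by (simp add: t_def)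
    have comb: "M x' + t *\<^sub>R M x0 \<in> psd_cone"
    proof -
      have "M x' + t *\<^sub>R M x0 = (M x' + (K * s) *\<^sub>R ?S) + t *\<^sub>R (M x0 - l *\<^sub>R ?S)"
        using l(1) by (simp add: t_def scaleR_diff_right)
      then show ?thesis by (simp only:) (intro psd_add psd_scale almost l(2) t0)
    qed
    define c where "c = 1 / (1 + t)"
    have c: "0 < c" "c \<le> 1" "c * (1 + t) = 1" using t0 by (auto simp: c_def)
    define u where "u = c *\<^sub>R (x' + t *\<^sub>R x0)"
    have lin: "T u = T x0"
    proof -
      have "T u = (c * (1 + t)) *\<^sub>R T x0"
        by (simp add: u_def linear_scale[OF T] linear_add[OF T] Tx' algebra_simps)
      then show ?thesis by (simp add: c(3))
    qed
    have Mu: "M u = c *\<^sub>R (M x' + t *\<^sub>R M x0)"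
      by (simp add: u_def linear_scale[OF M] linear_add[OF M])
    have "norm (x - u) \<le> \<kappa> * (2 + K / l) * e * (1 + norm (x - x0))"
    proof -
      have "x' - u = (c * t) *\<^sub>R (x' - x0)"
      proof -
        have "x' - u = (c * (1 + t)) *\<^sub>R x' - u" by (simp add: c(3))
        then show ?thesis by (simp add: u_def algebra_simps)
      qed
      then have "norm (x' - u) = c * t * norm (x' - x0)" using c(1) t0 by simp
      also have "\<dots> \<le> c * t * (norm (x - x0) + s)"
      proof (intro mult_left_mono)
        show "norm (x' - x0) \<le> norm (x - x0) + s"
          using xx' norm_triangle_ineq[of "x' - x" "x - x0"] by (simp add: norm_minus_commute)
      qed (use c(1) t0 in auto)
      also have "\<dots> = c * (t * norm (x - x0)) + (c * t) * s" by (simp add: algebra_simps)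
      also have "\<dots> \<le> 1 * (t * norm (x - x0)) + 1 * s"
        using c t0 s0 by (intro add_mono mult_right_mono) (auto simp: distrib_left)
      finally have "norm (x' - u) \<le> t * norm (x - x0) + s" by simp
      then have "norm (x - u) \<le> 2 * s + t * norm (x - x0)"
        using xx' norm_triangle_ineq[of "x - x'" "x' - u"] by simp
      also have "\<dots> = s * (2 + (K / l) * norm (x - x0))" by (simp add: t_def algebra_simps)
      also have "\<dots> \<le> s * ((2 + K / l) * (1 + norm (x - x0)))"
        using K(1) l(1) by (intro mult_left_mono s0) (simp add: algebra_simps)
      finally show ?thesis by (simp add: s_def mult_ac)
    qed
    moreover have "u \<in> W"
      unfolding u_def by (intro subspace_mul subspace_add W x'W x0(1))
    moreover have "M u \<in> psd_cone" unfolding Mu using c(1) by (intro psd_scale comb) simp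
    moreover have "M u ** R = 0"
      by (simp add: Mu mult_scale_left mult_add_left x'R x0(2))
    ultimately show "\<exists>u\<in>W. T u = T x0 \<and> M u \<in> psd_cone \<and> M u ** R = 0 \<and>
         norm (x - u) \<le> \<kappa> * (2 + K / l) * (norm (T x - T x0) + norm (M x ** R)) * (1 + norm (x - x0))"
      using lin unfolding e_def by blast
  qed
qed

section \<open>Strict complementarity\<close>

lemma normal_cone_polar_psd:
  assumes "Z \<in> psd_cone"
  shows "normal_cone (polar_cone psd_cone) (- Z) = {V \<in> psd_cone. V \<bullet> Z = 0}"
proof -
  have mem: "- Y \<in> polar_cone psd_cone \<longleftrightarrow> Y \<in> psd_cone" for Y :: "real ^ 'a ^ 'a"
    using subspace_neg[OF subspace_sym_mats, of Y] subspace_neg[OF subspace_sym_mats, of "- Y"]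
    by (auto simp: polar_cone_def psd_iff_inner_nonneg[of Y])
  have "V \<in> psd_cone \<and> V \<bullet> Z = 0"
    if V: "V \<in> sym_mats" "\<And>Y. Y \<in> polar_cone psd_cone \<Longrightarrow> V \<bullet> (Y + Z) \<le> 0" for V
  proof -
    have le: "V \<bullet> Z \<le> V \<bullet> Y" if "Y \<in> psd_cone" for Y
      using V(2)[of "- Y"] that by (simp add: mem inner_diff_right)
    have "0 \<le> V \<bullet> Y" if "Y \<in> psd_cone" for Y
      using le[OF psd_add[OF assms that]] by (simp add: inner_add_right)
    then have "V \<in> psd_cone" using V(1) by (simp add: psd_iff_inner_nonneg[of V])
    moreover have "V \<bullet> Z = 0"
      using le[OF zero_psd] psd_inner_nonneg[OF \<open>V \<in> psd_cone\<close> assms] by simp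
    ultimately show ?thesis by blast
  qed
  moreover have "V \<bullet> (Y + Z) \<le> 0"
    if "V \<in> psd_cone" "V \<bullet> Z = 0" "Y \<in> polar_cone psd_cone" for V Y
    using psd_inner_nonneg[OF that(1), of "- Y"] that mem[of "- Y"] by (simp add: inner_add_right)
  ultimately show ?thesis
    using assms mem[of Z] by (auto simp: normal_cone_def psd_sym)
qed

text \<open>
  The projector \<open>P\<close> onto the kernel of \<open>Z\<close> lies in the normal cone, which is the
  face of positive semidefinite matrices orthogonal to \<open>Z\<close>. A relative interior point of a
  convex set can be prolonged beyond itself along the segment from any other point of the set; the
  segment from \<open>P\<close> shows that \<open>X\<close> dominates a multiple of \<open>P\<close>, which
  is a bound for all vectors of the kernel at once.
\<close>

lemma strict_complementarity_projector:
  fixes X Z :: "real ^ 'n ^ 'n"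
  assumes Z: "Z \<in> psd_cone" and X: "X \<in> rel_interior (normal_cone (polar_cone psd_cone) (- Z))"
  obtains P t l where "P \<in> sym_mats" "P ** P = P" "Z ** P = 0" "X ** (mat 1 - P) = 0"
    "0 < t" "X - t *\<^sub>R P \<in> psd_cone" "0 < l" "Z - l *\<^sub>R (mat 1 - P) \<in> psd_cone"
proof -
  let ?N = "{V \<in> psd_cone. V \<bullet> Z = 0}"
  obtain P l where P: "P \<in> sym_mats" "P ** P = P" "Z ** P = 0" "0 < l"
    "Z - l *\<^sub>R (mat 1 - P) \<in> psd_cone"
    using kernel_projector[OF Z] by metis
  have XN: "X \<in> rel_interior ?N" using X by (simp add: normal_cone_polar_psd[OF Z])
  then have Xpsd: "X \<in> psd_cone" and XZ: "X \<bullet> Z = 0" using rel_interior_subset by auto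
  have "convex ?N"
    by (auto simp: convex_def psd_add psd_scale inner_add_left)
  moreover have "P \<in> ?N"
  proof -
    have "(Z ** P) \<bullet> P = Z \<bullet> (P ** transpose P)" by (rule inner_mult_right)
    then have "Z \<bullet> P = 0" using P(1-3) by (simp add: sym_mats_def)
    then show ?thesis by (simp add: projector_psd P inner_commute)
  qed
  ultimately obtain e where e: "1 < e" "(1 - e) *\<^sub>R P + e *\<^sub>R X \<in> ?N"
    using XN convex_rel_interior_iff[of ?N X] by blast
  have "X - ((e - 1) / e) *\<^sub>R P = (1 / e) *\<^sub>R ((1 - e) *\<^sub>R P + e *\<^sub>R X)"
    using e(1) by (simp add: scaleR_add_right diff_divide_distrib scaleR_diff_left algebra_simps)
  with e have psd: "X - ((e - 1) / e) *\<^sub>R P \<in> psd_cone" by (simp add: psd_scale)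
  have "X ** (mat 1 - P) = 0"
  proof -
    have "0 \<le> X \<bullet> (Z - l *\<^sub>R (mat 1 - P))" by (rule psd_inner_nonneg[OF Xpsd P(5)])
    then have "X \<bullet> (mat 1 - P) \<le> 0"
      using XZ P(4) by (simp add: inner_diff_right[of X Z] mult_le_0_iff)
    then have "(norm (X ** (mat 1 - P)))\<^sup>2 \<le> 0"
      using norm_mult_projector_le[OF Xpsd complement_projector(3,2)[OF P(1,2)]]
      by (smt (verit) mult_nonneg_nonpos norm_ge_zero)
    then show ?thesis by simp
  qed
  with P e(1) psd show thesis by (intro that[of P "(e - 1) / e" l]) auto
qed

section \<open>Growth of the dual objective and the primal error bound\<close>

lemma linear_sdp_op: "linear (sdp_op A)"
  by (rule linearI) (simp_all add: sdp_op_def vec_eq_iff inner_add_right)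

lemma linear_sdp_adj: "linear (sdp_adj A)"
  by (rule linearI) (simp_all add: sdp_adj_def sum.distrib scaleR_add_left scaleR_sum_right)

lemma sdp_adjoint: "sdp_adj A y \<bullet> X = y \<bullet> sdp_op A X"
  by (simp add: sdp_adj_def sdp_op_def inner_sum_left inner_vec_def[of y])

locale optimal_pair =
  fixes C :: "real ^ 'n ^ 'n" and A :: "'m::finite \<Rightarrow> real ^ 'n ^ 'n" and b :: "real ^ 'm"
    and Xs :: "real ^ 'n ^ 'n" and ys :: "real ^ 'm" and Zs :: "real ^ 'n ^ 'n"
  assumes data: "sdp_data C A"
    and duality: "strong_duality C A b"
    and Xs: "Xs \<in> primal_solutions C A b"
    and ws: "(ys, Zs) \<in> dual_solutions C A b"
begin

abbreviation "pval \<equiv> primal_value C A b"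

lemma C_sym: "C \<in> sym_mats" and A_sym: "A i \<in> sym_mats"
  using data by (auto simp: sdp_data_def)

lemma adj_sym: "sdp_adj A y \<in> sym_mats"
  unfolding sdp_adj_def by (intro subspace_sum subspace_mul subspace_sym_mats A_sym)

lemma Xs_psd: "Xs \<in> psd_cone" and Xs_op: "sdp_op A Xs = b" and Xs_val: "C \<bullet> Xs = pval"
  using Xs by (auto simp: primal_solutions_def primal_feasible_def)

lemma Zs_psd: "Zs \<in> psd_cone" and ws_adj: "sdp_adj A ys + Zs = C" and ws_val: "b \<bullet> ys = pval"
  using ws duality by (auto simp: dual_solutions_def dual_feasible_def strong_duality_def)

lemma dual_gap:
  assumes "(y, Z) \<in> dual_feasible C A"
  shows "pval - b \<bullet> y = Z \<bullet> Xs"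
proof -
  have "pval = (sdp_adj A y + Z) \<bullet> Xs"
    using assms Xs_val by (simp add: dual_feasible_def)
  also have "\<dots> = y \<bullet> b + Z \<bullet> Xs" by (simp add: inner_add_left sdp_adjoint Xs_op)
  finally show ?thesis by (simp add: inner_commute[of b])
qed

lemma dual_value_le: "(y, Z) \<in> dual_feasible C A \<Longrightarrow> b \<bullet> y \<le> pval"
  using dual_gap psd_inner_nonneg[OF _ Xs_psd] by (fastforce simp: dual_feasible_def)

lemma dual_solutions_iff:
  "(y, Z) \<in> dual_solutions C A b \<longleftrightarrow> (y, Z) \<in> dual_feasible C A \<and> Z \<bullet> Xs = 0"
  using dual_gap[of y Z] duality by (auto simp: dual_solutions_def strong_duality_def)

lemma primal_gap: "C \<bullet> X - pval = Zs \<bullet> X + (sdp_op A X - b) \<bullet> ys"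
proof -
  have "C \<bullet> X = (sdp_adj A ys + Zs) \<bullet> X" by (simp add: ws_adj)
  also have "\<dots> = ys \<bullet> sdp_op A X + Zs \<bullet> X" by (simp add: inner_add_left sdp_adjoint)
  finally show ?thesis by (simp add: inner_diff_left ws_val inner_commute[of ys])
qed

lemma primal_solutions_iff:
  "X \<in> primal_solutions C A b \<longleftrightarrow> X \<in> psd_cone \<and> sdp_op A X = b \<and> Zs \<bullet> X = 0"
  using primal_gap[of X] by (auto simp: primal_solutions_def primal_feasible_def)

text \<open>
  The suboptimality is \<open>Z \<bullet> Xs\<close>, which is at least \<open>t\<close> times
  \<open>Z \<bullet> P\<close>. Dual feasible points satisfy the equation \<open>sdp_adj A y + Z = C\<close>
  exactly, so the only residual in the face error bound is \<open>Z P\<close>.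
\<close>

lemma dual_quadratic_growth:
  assumes P: "P \<in> sym_mats" "P ** P = P" "Zs ** P = 0" "Xs ** (mat 1 - P) = 0"
    and t: "0 < t" "Xs - t *\<^sub>R P \<in> psd_cone"
    and l: "0 < l" "Zs - l *\<^sub>R (mat 1 - P) \<in> psd_cone"
  obtains \<kappa> where "0 < \<kappa>"
    "\<And>y Z. (y, Z) \<in> dual_feasible C A \<Longrightarrow> norm ((y, Z) - (ys, Zs)) \<le> B \<Longrightarrow>
       (infdist (y, Z) (dual_solutions C A b))\<^sup>2 \<le> \<kappa> * (pval - b \<bullet> y)"
proof -
  define T where "T w = sdp_adj A (fst w) + snd w" for w :: "(real ^ 'm) \<times> (real ^ 'n ^ 'n)"
  have T: "linear T"
    unfolding T_def
    by (rule linearI) (simp_all add: linear_add[OF linear_sdp_adj] linear_scale[OF linear_sdp_adj]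
        scaleR_add_right)
  have W: "subspace (UNIV \<times> sym_mats :: ((real ^ 'm) \<times> (real ^ 'n ^ 'n)) set)"
    by (intro subspace_Times subspace_UNIV subspace_sym_mats)
  obtain \<kappa> where k: "0 < \<kappa>"
    "\<And>w. w \<in> UNIV \<times> sym_mats \<Longrightarrow> snd w \<in> psd_cone \<Longrightarrow>
       \<exists>u\<in>UNIV \<times> sym_mats. T u = T (ys, Zs) \<and> snd u \<in> psd_cone \<and> snd u ** P = 0 \<and>
         norm (w - u) \<le> \<kappa> * (norm (T w - T (ys, Zs)) + norm (snd w ** P)) * (1 + norm (w - (ys, Zs)))"
    by (rule face_error_bound[OF T linear_snd W _ P(1,2), of "(ys, Zs)" l])
      (use P(3) l psd_sym[OF Zs_psd] in auto)
  define \<kappa>' where "\<kappa>' = (\<kappa> * (1 + \<bar>B\<bar>))\<^sup>2 * ((norm Zs + \<bar>B\<bar>) / t) + 1"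
  have pos: "0 < \<kappa>'" using t(1) by (simp add: \<kappa>'_def add_nonneg_pos)
  show thesis
  proof (rule that[OF pos])
    fix y Z assume feas: "(y, Z) \<in> dual_feasible C A" and B: "norm ((y, Z) - (ys, Zs)) \<le> B"
    have Z: "Z \<in> psd_cone" "sdp_adj A y + Z = C" using feas by (auto simp: dual_feasible_def)
    have "T (y, Z) = T (ys, Zs)" by (simp add: T_def Z(2) ws_adj)
    then obtain u where u: "T u = C" "snd u \<in> psd_cone" "snd u ** P = 0"
      "norm ((y, Z) - u) \<le> \<kappa> * norm (Z ** P) * (1 + norm ((y, Z) - (ys, Zs)))"
      using k(2)[of "(y, Z)"] Z(1) psd_sym[OF Z(1)] by (auto simp: T_def ws_adj)
    have "u \<in> dual_solutions C A b"
    proof (cases u)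
      case (Pair v V)
      have "Xs ** P = Xs"
      proof -
        have "Xs = Xs ** (mat 1 - P) + Xs ** P" by (simp add: matrix_add_ldistrib[symmetric])
        then show ?thesis using P(4) by simp
      qed
      then have "V \<bullet> Xs = V \<bullet> (Xs ** transpose P)" using P(1) by (simp add: sym_mats_def)
      also have "\<dots> = (V ** P) \<bullet> Xs" by (rule inner_mult_right[symmetric])
      also have "\<dots> = 0" using u(3) Pair by simp
      finally show ?thesis using u(1,2) Pair by (simp add: dual_solutions_iff dual_feasible_def T_def)
    qed
    then have "infdist (y, Z) (dual_solutions C A b) \<le> norm ((y, Z) - u)"
      by (metis dist_norm infdist_le)
    also have "\<dots> \<le> \<kappa> * norm (Z ** P) * (1 + \<bar>B\<bar>)"
    proof (rule order_trans[OF u(4)], intro mult_left_mono)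
      show "1 + norm ((y, Z) - (ys, Zs)) \<le> 1 + \<bar>B\<bar>" using B by linarith
    qed (use k(1) in simp)
    finally have "(infdist (y, Z) (dual_solutions C A b))\<^sup>2 \<le> (\<kappa> * norm (Z ** P) * (1 + \<bar>B\<bar>))\<^sup>2"
      by (rule power_mono[OF _ infdist_nonneg])
    also have "\<dots> = (\<kappa> * (1 + \<bar>B\<bar>))\<^sup>2 * (norm (Z ** P))\<^sup>2" by (simp add: power_mult_distrib)
    also have "\<dots> \<le> (\<kappa> * (1 + \<bar>B\<bar>))\<^sup>2 * ((norm Zs + \<bar>B\<bar>) / t * (pval - b \<bullet> y))"
    proof (rule mult_left_mono)
      have "norm (Z - Zs) \<le> B"
        using B norm_snd_le[of "Z - Zs" "y - ys"] by simp
      then have nZ: "norm Z \<le> norm Zs + \<bar>B\<bar>" using norm_triangle_sub[of Z Zs] by linarith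
      have "0 \<le> Z \<bullet> (Xs - t *\<^sub>R P)" by (rule psd_inner_nonneg[OF Z(1) t(2)])
      then have ZP: "Z \<bullet> P \<le> (pval - b \<bullet> y) / t"
        using t(1) by (simp add: dual_gap[OF feas] inner_diff_right field_simps)
      have "(norm (Z ** P))\<^sup>2 \<le> norm Z * (Z \<bullet> P)"
        by (rule norm_mult_projector_le[OF Z(1) projector_psd[OF P(1,2)] P(2)])
      also have "\<dots> \<le> (norm Zs + \<bar>B\<bar>) * ((pval - b \<bullet> y) / t)"
        using psd_inner_nonneg[OF Z(1) projector_psd[OF P(1,2)]]
        by (intro mult_mono nZ ZP) auto
      finally show "(norm (Z ** P))\<^sup>2 \<le> (norm Zs + \<bar>B\<bar>) / t * (pval - b \<bullet> y)" by simp
    qed simp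
    also have "\<dots> \<le> \<kappa>' * (pval - b \<bullet> y)"
      using dual_value_le[OF feas] unfolding \<kappa>'_def mult.assoc[symmetric]
      by (intro mult_right_mono) auto
    finally show "(infdist (y, Z) (dual_solutions C A b))\<^sup>2 \<le> \<kappa>' * (pval - b \<bullet> y)" .
  qed
qed

text \<open>
  The normalized points of an unbounded sequence accumulate at a unit vector along which
  feasibility persists and the objective does not increase, so that from any solution a whole ray
  of solutions emanates.
\<close>

lemma bounded_near_optimal:
  assumes bdd: "bounded (primal_solutions C A b)"
  shows "bounded {X \<in> psd_cone. norm (sdp_op A X - b) \<le> a \<and> C \<bullet> X \<le> pval + a}" (is "bounded ?S")
proof (rule ccontr)
  assume "\<not> bounded ?S"
  then have "\<forall>n. \<exists>X. X \<in> ?S \<and> real (Suc n) < norm X"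
    unfolding bounded_iff not_le[symmetric] by blast
  then obtain Y where Y': "\<forall>n. Y n \<in> ?S \<and> real (Suc n) < norm (Y n)"
    unfolding choice_iff ..
  then have Y: "Y n \<in> ?S" "real (Suc n) < norm (Y n)" for n
    by (blast, blast)
  define c where "c n = inverse (norm (Y n))" for n
  have Y0: "0 < norm (Y n)" for n using Y(2)[of n] by linarith
  have c0: "0 < c n" for n using Y0[of n] by (simp add: c_def)
  have c_lim: "c \<longlonglongrightarrow> 0"
  proof (rule tendsto_sandwich[of "\<lambda>_. 0" _ _ "\<lambda>n. inverse (real (Suc n))"])
    show "\<forall>\<^sub>F n in sequentially. c n \<le> inverse (real (Suc n))"
      unfolding c_def by (intro always_eventually allI le_imp_inverse_le less_imp_le[OF Y(2)]) simp
    show "(\<lambda>n. inverse (real (Suc n))) \<longlonglongrightarrow> 0" by (rule LIMSEQ_inverse_real_of_nat)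
    show "\<forall>\<^sub>F n in sequentially. 0 \<le> c n"
      by (intro always_eventually allI less_imp_le[OF c0])
  qed simp
  define D where "D n = c n *\<^sub>R Y n" for n
  have "\<forall>n. D n \<in> sphere 0 1" using Y0 by (simp add: D_def c_def)
  then obtain E \<rho> where E: "E \<in> sphere 0 1" "strict_mono \<rho>" "(D \<circ> \<rho>) \<longlonglongrightarrow> E"
    by (rule seq_compactE[OF compact_imp_seq_compact[OF compact_sphere]])
  have c\<rho>: "(\<lambda>n. c (\<rho> n)) \<longlonglongrightarrow> 0"
    using LIMSEQ_subseq_LIMSEQ[OF c_lim E(2)] by (simp add: o_def)
  have E': "(\<lambda>n. D (\<rho> n)) \<longlonglongrightarrow> E" using E(3) by (simp add: o_def)
  have Epsd: "E \<in> psd_cone"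
  proof (rule closed_sequentially[OF closed_psd _ E'])
    show "\<And>n. D (\<rho> n) \<in> psd_cone"
      using Y(1) unfolding D_def by (intro psd_scale less_imp_le[OF c0]) blast
  qed
  have AE: "sdp_op A E = 0"
  proof -
    have 1: "(\<lambda>n. sdp_op A (D (\<rho> n))) \<longlonglongrightarrow> sdp_op A E"
      by (rule bounded_linear.tendsto[OF _ E'])
        (simp add: linear_sdp_op flip: linear_conv_bounded_linear)
    have lim0: "(\<lambda>n. c (\<rho> n) * (a + norm b)) \<longlonglongrightarrow> 0"
      by (rule tendsto_mult_left_zero[OF c\<rho>])
    have bound: "norm (sdp_op A (D (\<rho> n))) \<le> c (\<rho> n) * (a + norm b)" for n
    proof -
      have "norm (sdp_op A (Y (\<rho> n))) \<le> a + norm b"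
        using Y(1)[of "\<rho> n"] norm_triangle_sub[of "sdp_op A (Y (\<rho> n))" b]
        by simp
      then show ?thesis using c0[of "\<rho> n"]
        by (simp add: D_def linear_scale[OF linear_sdp_op])
    qed
    have "(\<lambda>n. sdp_op A (D (\<rho> n))) \<longlonglongrightarrow> 0"
      by (rule Lim_null_comparison[OF always_eventually lim0]) (intro allI bound)
    with 1 show ?thesis by (rule LIMSEQ_unique)
  qed
  have CE: "C \<bullet> E \<le> 0"
  proof (rule LIMSEQ_le)
    show "(\<lambda>n. C \<bullet> D (\<rho> n)) \<longlonglongrightarrow> C \<bullet> E" by (intro tendsto_intros E')
    show "(\<lambda>n. c (\<rho> n) * (pval + a)) \<longlonglongrightarrow> 0" by (rule tendsto_mult_left_zero[OF c\<rho>])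
    show "\<exists>N. \<forall>n\<ge>N. C \<bullet> D (\<rho> n) \<le> c (\<rho> n) * (pval + a)"
      using Y(1) c0 by (auto simp: D_def)
  qed
  have "C \<bullet> E = Zs \<bullet> E"
    using sdp_adjoint[of A ys E] by (simp add: ws_adj[symmetric] inner_add_left AE)
  with CE psd_inner_nonneg[OF Zs_psd Epsd] have ZE: "Zs \<bullet> E = 0" by simp
  obtain B where B: "\<And>X. X \<in> primal_solutions C A b \<Longrightarrow> norm X \<le> B"
    using bdd unfolding bounded_iff by blast
  define t where "t = \<bar>B\<bar> + norm Xs + 1"
  have "Xs + t *\<^sub>R E \<in> primal_solutions C A b"
    using Xs ZE AE psd_add[OF Xs_psd psd_scale[OF Epsd, of t]]
    by (simp add: primal_solutions_iff linear_add[OF linear_sdp_op] linear_scale[OF linear_sdp_op]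
        inner_add_right t_def)
  then have "norm (Xs + t *\<^sub>R E) \<le> B" by (rule B)
  moreover have "norm (t *\<^sub>R E) \<le> norm (Xs + t *\<^sub>R E) + norm Xs"
    using norm_triangle_ineq4[of "Xs + t *\<^sub>R E" Xs] by simp
  moreover have "norm (t *\<^sub>R E) = t" using E(1) by (simp add: t_def)
  ultimately have "t \<le> B + norm Xs" by linarith
  then show False by (simp add: t_def)
qed

text \<open>
  The roles of \<open>P\<close> and \<open>1 - P\<close> are exchanged: primal solutions are
  characterized by \<open>X (1 - P) = 0\<close>, and \<open>Zs \<bullet> X\<close>, which dominates a multiple of
  \<open>(1 - P) \<bullet> X\<close>, is the objective residual up to the infeasibility of the linear
  constraints. The residual of the linear constraints is of order \<open>\<eta>\<close> itself; the upper
  bound \<open>H\<close> on \<open>\<eta>\<close> serves to absorb it into the order \<open>sqrt \<eta>\<close>.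
\<close>

lemma primal_error_bound:
  assumes P: "P \<in> sym_mats" "P ** P = P" "Zs ** P = 0" "Xs ** (mat 1 - P) = 0"
    and t: "0 < t" "Xs - t *\<^sub>R P \<in> psd_cone"
    and l: "0 < l" "Zs - l *\<^sub>R (mat 1 - P) \<in> psd_cone"
    and bdd: "bounded (primal_solutions C A b)" and M: "0 \<le> M"
  obtains \<tau> where "0 < \<tau>"
    "\<And>X \<eta>. 0 \<le> \<eta> \<Longrightarrow> \<eta> \<le> H \<Longrightarrow> X \<in> psd_cone \<Longrightarrow> norm (sdp_op A X - b) \<le> M * \<eta> \<Longrightarrow>
       C \<bullet> X - pval \<le> M * \<eta> \<Longrightarrow> (infdist X (primal_solutions C A b))\<^sup>2 \<le> \<tau> * \<eta>"
proof -
  let ?S = "mat 1 - P"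
  have S: "?S \<in> sym_mats" "?S ** ?S = ?S" "?S \<in> psd_cone"
    using complement_projector[OF P(1,2)] by auto
  have t': "Xs - t *\<^sub>R (mat 1 - ?S) \<in> psd_cone" using t(2) by simp
  obtain \<kappa> where k: "0 < \<kappa>"
    "\<And>X. X \<in> sym_mats \<Longrightarrow> X \<in> psd_cone \<Longrightarrow>
       \<exists>u\<in>sym_mats. sdp_op A u = sdp_op A Xs \<and> u \<in> psd_cone \<and> u ** ?S = 0 \<and>
         norm (X - u) \<le> \<kappa> * (norm (sdp_op A X - sdp_op A Xs) + norm (X ** ?S)) * (1 + norm (X - Xs))"
    by (rule face_error_bound[OF linear_sdp_op[of A] linear_id subspace_sym_mats _ S(1,2),
          unfolded id_apply, OF _ psd_sym[OF Xs_psd] P(4) t(1) t']) auto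
  obtain B where "\<forall>X\<in>{X \<in> psd_cone. norm (sdp_op A X - b) \<le> M * \<bar>H\<bar> \<and>
      C \<bullet> X \<le> pval + M * \<bar>H\<bar>}. norm X \<le> B"
    using bounded_near_optimal[OF bdd, of "M * \<bar>H\<bar>"] unfolding bounded_iff ..
  then have B: "norm X \<le> B" if "X \<in> psd_cone" "norm (sdp_op A X - b) \<le> M * \<bar>H\<bar>"
      "C \<bullet> X \<le> pval + M * \<bar>H\<bar>" for X
    using that by simp
  define N where "N = \<bar>B\<bar> * (M * (1 + norm ys) / l)"
  have N0: "0 \<le> N" using M l(1) by (simp add: N_def)
  define G where "G = \<kappa> * (1 + (\<bar>B\<bar> + norm Xs))"
  define \<tau> where "\<tau> = (G * (M * sqrt \<bar>H\<bar> + sqrt N))\<^sup>2 + 1"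
  have pos: "0 < \<tau>" by (simp add: \<tau>_def add_nonneg_pos)
  show thesis
  proof (rule that[OF pos])
    fix X \<eta> assume eta: "0 \<le> \<eta>" "\<eta> \<le> H" and X: "X \<in> psd_cone"
      and op: "norm (sdp_op A X - b) \<le> M * \<eta>" and val: "C \<bullet> X - pval \<le> M * \<eta>"
    have "M * \<eta> \<le> M * \<bar>H\<bar>" using eta M by (intro mult_left_mono) auto
    with op val have XB: "norm X \<le> \<bar>B\<bar>" using B[OF X] by fastforce
    have ZX: "Zs \<bullet> X \<le> M * (1 + norm ys) * \<eta>"
    proof -
      have "- ((sdp_op A X - b) \<bullet> ys) \<le> norm (sdp_op A X - b) * norm ys"
        using Cauchy_Schwarz_ineq2[of "sdp_op A X - b" ys] by linarith
      also have "\<dots> \<le> M * \<eta> * norm ys" by (intro mult_right_mono op) simp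
      finally show ?thesis using val primal_gap[of X] by (simp add: algebra_simps)
    qed
    have "0 \<le> (Zs - l *\<^sub>R ?S) \<bullet> X" by (rule psd_inner_nonneg[OF l(2) X])
    then have "l * (?S \<bullet> X) \<le> M * (1 + norm ys) * \<eta>"
      using ZX by (simp only: inner_diff_left inner_scaleR_left)
    then have "?S \<bullet> X \<le> M * (1 + norm ys) * \<eta> / l"
      by (simp only: pos_le_divide_eq[OF l(1)] mult.commute[of _ l])
    then have SX: "X \<bullet> ?S \<le> M * (1 + norm ys) / l * \<eta>"
      by (simp only: inner_commute[of X] times_divide_eq_left)
    have "(norm (X ** ?S))\<^sup>2 \<le> norm X * (X \<bullet> ?S)"
      by (rule norm_mult_projector_le[OF X S(3,2)])
    also have "\<dots> \<le> \<bar>B\<bar> * (M * (1 + norm ys) / l * \<eta>)"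
      by (intro mult_mono XB SX psd_inner_nonneg X S) simp
    finally have "norm (X ** ?S) \<le> sqrt (N * \<eta>)"
      by (intro real_le_rsqrt) (simp add: N_def)
    then have XS: "norm (X ** ?S) \<le> sqrt N * sqrt \<eta>" by (simp add: real_sqrt_mult)
    have "M * \<eta> = M * (sqrt \<eta> * sqrt \<eta>)" using eta by simp
    also have "\<dots> \<le> M * (sqrt \<bar>H\<bar> * sqrt \<eta>)"
      using eta M by (intro mult_left_mono mult_right_mono) auto
    finally have op': "norm (sdp_op A X - b) \<le> M * sqrt \<bar>H\<bar> * sqrt \<eta>" using op by simp
    obtain u where u: "sdp_op A u = b" "u \<in> psd_cone" "u ** ?S = 0"
      "norm (X - u) \<le> \<kappa> * (norm (sdp_op A X - b) + norm (X ** ?S)) * (1 + norm (X - Xs))"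
      using k(2)[OF psd_sym[OF X] X] by (auto simp: Xs_op)
    have "u \<in> primal_solutions C A b"
    proof -
      have "Zs = Zs ** ?S"
      proof -
        have "Zs = Zs ** (mat 1 - P) + Zs ** P" by (simp add: matrix_add_ldistrib[symmetric])
        then show ?thesis using P(3) by simp
      qed
      then have "u \<bullet> Zs = u \<bullet> (Zs ** transpose ?S)" using S(1) by (simp add: sym_mats_def)
      also have "\<dots> = (u ** ?S) \<bullet> Zs" by (rule inner_mult_right[symmetric])
      finally have "Zs \<bullet> u = 0" using u(3) by (simp add: inner_commute)
      then show ?thesis using u(1,2) by (simp add: primal_solutions_iff)
    qed
    then have "infdist X (primal_solutions C A b) \<le> norm (X - u)"
      by (metis dist_norm infdist_le)
    also have "\<dots> \<le> \<kappa> * (M * sqrt \<bar>H\<bar> * sqrt \<eta> + sqrt N * sqrt \<eta>) * (1 + (\<bar>B\<bar> + norm Xs))"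
    proof -
      let ?a = "M * sqrt \<bar>H\<bar> * sqrt \<eta> + sqrt N * sqrt \<eta>"
      have a: "norm (sdp_op A X - b) + norm (X ** ?S) \<le> ?a" by (rule add_mono[OF op' XS])
      have "0 \<le> norm (sdp_op A X - b) + norm (X ** ?S)" by (rule add_nonneg_nonneg) (rule norm_ge_zero)+
      with a have "0 \<le> ?a" by (rule order_trans[rotated])
      then have "0 \<le> \<kappa> * ?a" by (rule mult_nonneg_nonneg[OF less_imp_le[OF k(1)]])
      moreover have "\<kappa> * (norm (sdp_op A X - b) + norm (X ** ?S)) \<le> \<kappa> * ?a"
        by (rule mult_left_mono[OF a less_imp_le[OF k(1)]])
      moreover have "1 + norm (X - Xs) \<le> 1 + (\<bar>B\<bar> + norm Xs)"
        using XB norm_triangle_ineq4[of X Xs] by linarith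
      moreover have "0 \<le> 1 + norm (X - Xs)" by (rule add_nonneg_nonneg) simp_all
      ultimately show ?thesis by (intro order_trans[OF u(4) mult_mono])
    qed
    also have "\<dots> = G * (M * sqrt \<bar>H\<bar> + sqrt N) * sqrt \<eta>" by (simp add: G_def algebra_simps)
    finally have "(infdist X (primal_solutions C A b))\<^sup>2 \<le> (G * (M * sqrt \<bar>H\<bar> + sqrt N) * sqrt \<eta>)\<^sup>2"
      by (rule power_mono[OF _ infdist_nonneg])
    also have "\<dots> = (G * (M * sqrt \<bar>H\<bar> + sqrt N))\<^sup>2 * \<eta>"
      using eta by (simp add: power_mult_distrib)
    also have "\<dots> \<le> \<tau> * \<eta>" using eta by (intro mult_right_mono) (auto simp: \<tau>_def)
    finally show "(infdist X (primal_solutions C A b))\<^sup>2 \<le> \<tau> * \<eta>" .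
  qed
qed

end

section \<open>The multiplier update as an inexact proximal step\<close>

definition prox_objective ::
    "real ^ 'm::finite \<Rightarrow> real \<Rightarrow> (real ^ 'm) \<times> (real ^ 'n ^ 'n) \<Rightarrow> (real ^ 'm) \<times> (real ^ 'n ^ 'n) \<Rightarrow> real"
  where "prox_objective b r w v = b \<bullet> fst v - (norm (v - w))\<^sup>2 / (2 * r)"

text \<open>
  Completing the square in \<open>prox_objective\<close> shows that its maximizer over the dual feasible
  set is the point closest to \<open>w + r (b, 0)\<close>. In this form existence, uniqueness and the
  variational inequality are those of a metric projection.
\<close>

definition prox_step ::
    "real ^ 'n ^ 'n \<Rightarrow> ('m::finite \<Rightarrow> real ^ 'n ^ 'n) \<Rightarrow> real ^ 'm \<Rightarrow> real
      \<Rightarrow> (real ^ 'm) \<times> (real ^ 'n ^ 'n) \<Rightarrow> (real ^ 'm) \<times> (real ^ 'n ^ 'n)"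
  where "prox_step C A b r w = closest_point (dual_feasible C A) (w + r *\<^sub>R (b, 0))"

lemma norm_prod_sq: "(norm (x, y))\<^sup>2 = (norm x)\<^sup>2 + (norm y)\<^sup>2"
  by (simp add: norm_prod_def)

lemma norm_add_sq: "(norm (x + y))\<^sup>2 = (norm x)\<^sup>2 + 2 * (x \<bullet> y) + (norm (y :: 'a::real_inner))\<^sup>2"
  by (simp add: power2_norm_eq_inner inner_add_left inner_add_right inner_commute)

lemma norm_diff_sq: "(norm (x - y))\<^sup>2 = (norm x)\<^sup>2 - 2 * (x \<bullet> y) + (norm (y :: 'a::real_inner))\<^sup>2"
  by (simp add: power2_norm_eq_inner inner_diff_left inner_diff_right inner_commute)

lemma aug_lagrangian_eq:
  assumes "0 < r"
  shows "aug_lagrangian C A b r X w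
    = C \<bullet> X + ((norm (alm_update A b r X w))\<^sup>2 - (norm w)\<^sup>2) / (2 * r)"
  by (cases w) (simp add: aug_lagrangian_def alm_update_def norm_prod_sq diff_diff_eq)

text \<open>
  The augmented Lagrangian is the maximum over \<open>v\<close> of the Lagrangian minus a quadratic
  penalty; here its value is read off at the maximizer, which is the multiplier update. The
  projection residual is orthogonal to the projection, and this removes the cross terms.
\<close>

lemma aug_lagrangian_as_lagrangian:
  assumes r: "0 < r" and v: "v = alm_update A b r X w"
  shows "aug_lagrangian C A b r X w
    = C \<bullet> X + fst v \<bullet> (b - sdp_op A X) - snd v \<bullet> X - (norm (v - w))\<^sup>2 / (2 * r)"
proof -
  obtain y Z where w: "w = (y, Z)" by (cases w)
  define g where "g = b - sdp_op A X"
  define p where "p = proj_psd (Z - r *\<^sub>R X)"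
  have v': "v = (y + r *\<^sub>R g, p)" by (simp add: v w alm_update_def g_def p_def)
  have "(p - (Z - r *\<^sub>R X)) \<bullet> p = 0" unfolding p_def by (rule proj_psd_orthogonal)
  then have p: "p \<bullet> p = p \<bullet> Z - r * (p \<bullet> X)"
    by (simp add: inner_diff_left inner_diff_right inner_commute)
  have "(norm v)\<^sup>2 - (norm w)\<^sup>2 + (norm (v - w))\<^sup>2 = 2 * r * ((y + r *\<^sub>R g) \<bullet> g - p \<bullet> X)"
    unfolding v' w power2_norm_eq_inner
    by (simp add: p inner_add_left inner_add_right inner_diff_left inner_diff_right inner_commute
        algebra_simps)
  then have "((norm v)\<^sup>2 - (norm w)\<^sup>2) / (2 * r)
      = (y + r *\<^sub>R g) \<bullet> g - p \<bullet> X - (norm (v - w))\<^sup>2 / (2 * r)"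
    using r by (simp add: field_simps)
  then show ?thesis
    unfolding aug_lagrangian_eq[OF r] v[symmetric] by (simp add: v' g_def)
qed

text \<open>
  At a dual feasible \<open>u\<close> the Lagrangian does not depend on \<open>X\<close> and equals the dual
  objective. Strong concavity in the multiplier yields the additional squared distance to the
  maximizer \<open>v\<close>.
\<close>

lemma aug_lagrangian_ge:
  assumes r: "0 < r" and u: "u \<in> dual_feasible C A" and v: "v = alm_update A b r X w"
  shows "prox_objective b r w u + (norm (u - v))\<^sup>2 / (2 * r) \<le> aug_lagrangian C A b r X w"
proof -
  obtain y Z where w: "w = (y, Z)" by (cases w)
  obtain y' Z' where u': "u = (y', Z')" by (cases u)
  define g where "g = b - sdp_op A X"
  define p where "p = proj_psd (Z - r *\<^sub>R X)"
  have v': "v = (y + r *\<^sub>R g, p)" by (simp add: v w alm_update_def g_def p_def)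
  have feas: "Z' \<in> psd_cone" "sdp_adj A y' + Z' = C" using u u' by (auto simp: dual_feasible_def)
  have "C \<bullet> X = y' \<bullet> sdp_op A X + Z' \<bullet> X"
    by (simp add: feas(2)[symmetric] inner_add_left sdp_adjoint)
  then have CX: "C \<bullet> X = b \<bullet> y' - g \<bullet> y' + Z' \<bullet> X"
    by (simp add: g_def inner_diff_left inner_diff_right inner_commute)
  have "0 \<le> (p - (Z - r *\<^sub>R X)) \<bullet> Z'" unfolding p_def by (rule proj_psd_polar[OF feas(1)])
  then have pZ: "0 \<le> p \<bullet> Z' - Z \<bullet> Z' + r * (X \<bullet> Z')" by (simp add: inner_diff_left)
  have "(norm v)\<^sup>2 - (norm w)\<^sup>2 + (norm (u - w))\<^sup>2 - (norm (u - v))\<^sup>2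
      = 2 * r * (g \<bullet> y') + 2 * (p \<bullet> Z' - Z \<bullet> Z')"
    unfolding v' w u'
    by (simp add: norm_prod_sq norm_add_sq norm_diff_sq inner_add_left inner_add_right
        inner_commute algebra_simps)
  with pZ have "2 * r * (g \<bullet> y' - X \<bullet> Z')
      \<le> (norm v)\<^sup>2 - (norm w)\<^sup>2 + (norm (u - w))\<^sup>2 - (norm (u - v))\<^sup>2"
    by (simp add: algebra_simps)
  then have "g \<bullet> y' - X \<bullet> Z'
      \<le> ((norm v)\<^sup>2 - (norm w)\<^sup>2 + (norm (u - w))\<^sup>2 - (norm (u - v))\<^sup>2) / (2 * r)"
    using r by (simp add: pos_le_divide_eq mult.commute)
  moreover have "aug_lagrangian C A b r X w
      = b \<bullet> y' - g \<bullet> y' + Z' \<bullet> X + ((norm v)\<^sup>2 - (norm w)\<^sup>2) / (2 * r)"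
    unfolding aug_lagrangian_eq[OF r] v[symmetric] CX ..
  ultimately show ?thesis
    by (simp add: prox_objective_def u' add_divide_distrib diff_divide_distrib inner_commute)
qed

lemma closed_dual_feasible: "closed (dual_feasible C A)"
proof -
  have "dual_feasible C A = snd -` psd_cone \<inter> {w. sdp_adj A (fst w) + snd w = C}"
    by (auto simp: dual_feasible_def)
  also have "closed \<dots>"
    unfolding sdp_adj_def
    by (intro closed_Int closed_vimage closed_psd closed_Collect_eq continuous_intros)
  finally show ?thesis .
qed

lemma convex_dual_feasible: "convex (dual_feasible C A)"
proof -
  have "u *\<^sub>R sdp_adj A y + u *\<^sub>R Z + (v *\<^sub>R sdp_adj A y' + v *\<^sub>R Z') = C"
    if "sdp_adj A y + Z = C" "sdp_adj A y' + Z' = C" "u + v = 1" for u v y y' Z Z'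
    using that by (simp flip: scaleR_add_right scaleR_add_left)
  then show ?thesis
    by (auto simp: convex_def dual_feasible_def linear_add[OF linear_sdp_adj]
        linear_scale[OF linear_sdp_adj] psd_add psd_scale algebra_simps)
qed

lemma prox_step_feasible: "dual_feasible C A \<noteq> {} \<Longrightarrow> prox_step C A b r w \<in> dual_feasible C A"
  unfolding prox_step_def by (rule closest_point_in_set[OF closed_dual_feasible])

text \<open>
  The additional squared distance is the variational inequality of the projection that defines
  \<open>prox_step\<close>.
\<close>

lemma prox_step_optimal:
  assumes r: "0 < r" and u: "u \<in> dual_feasible C A" and p: "p = prox_step C A b r w"
  shows "prox_objective b r w u + (norm (u - p))\<^sup>2 / (2 * r) \<le> prox_objective b r w p"
proof -
  have "(w + r *\<^sub>R (b, 0) - p) \<bullet> (u - p) \<le> 0"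
    unfolding p prox_step_def by (rule closest_point_dot[OF convex_dual_feasible closed_dual_feasible u])
  moreover have "(w + r *\<^sub>R (b, 0) - p) \<bullet> (u - p) = (w - p) \<bullet> (u - p) + r * (b \<bullet> fst u - b \<bullet> fst p)"
    by (cases u, cases p, cases w)
      (simp add: inner_diff_left inner_add_left inner_diff_right algebra_simps)
  moreover have "(norm (u - w))\<^sup>2 = (norm (u - p))\<^sup>2 - 2 * ((w - p) \<bullet> (u - p)) + (norm (p - w))\<^sup>2"
    using norm_diff_sq[of "u - p" "w - p"] by (simp add: inner_commute norm_minus_commute)
  ultimately have "2 * r * (b \<bullet> fst u - b \<bullet> fst p) \<le> (norm (u - w))\<^sup>2 - (norm (u - p))\<^sup>2 - (norm (p - w))\<^sup>2"
    by simp
  then have "b \<bullet> fst u - b \<bullet> fst p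
      \<le> ((norm (u - w))\<^sup>2 - (norm (u - p))\<^sup>2 - (norm (p - w))\<^sup>2) / (2 * r)"
    using r by (simp add: pos_le_divide_eq mult.commute)
  then show ?thesis by (simp add: prox_objective_def diff_divide_distrib)
qed

lemma quadratic_bound_imp_le:
  fixes x :: real
  assumes "x\<^sup>2 \<le> c + d * x" "0 \<le> c" "0 \<le> d"
  shows "x \<le> c + d + 1"
proof (rule ccontr)
  assume "\<not> x \<le> c + d + 1"
  then have x: "c + d + 1 < x" by simp
  then have "(c + d + 1) * x < x * x" using assms by (intro mult_strict_right_mono) auto
  moreover have "c * 1 \<le> c * x" using assms x by (intro mult_left_mono) auto
  ultimately show False using assms x by (simp add: power2_eq_square algebra_simps)
qed

text \<open>
  This set is the hypograph of the optimal value of the proximal problem as a function of a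
  perturbation of the equation \<open>sdp_adj A y + Z = C\<close>. The quadratic term makes the points
  \<open>v\<close> belonging to a convergent sequence bounded, so a subsequence of them converges.
\<close>

lemma closed_prox_hypograph:
  fixes b :: "real ^ 'm::finite" and C :: "real ^ 'n ^ 'n"
  assumes r: "0 < r"
  shows "closed {h. \<exists>v. snd v \<in> psd_cone \<and> fst h = C - (sdp_adj A (fst v) + snd v) \<and>
      snd h \<le> prox_objective b r w v}"
    (is "closed ?H")
  unfolding closed_sequential_limits
proof (intro allI impI, elim conjE)
  fix h :: "nat \<Rightarrow> (real ^ 'n ^ 'n) \<times> real" and l
  assume h: "\<forall>n. h n \<in> ?H" and lim: "h \<longlonglongrightarrow> l"
  from h have "\<forall>n. \<exists>v. snd v \<in> psd_cone \<and> fst (h n) = C - (sdp_adj A (fst v) + snd v) \<and>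
      snd (h n) \<le> prox_objective b r w v"
    by simp
  then obtain v where v: "\<forall>n. snd (v n) \<in> psd_cone \<and> fst (h n) = C - (sdp_adj A (fst (v n)) + snd (v n)) \<and>
      snd (h n) \<le> prox_objective b r w (v n)"
    unfolding choice_iff ..
  have limU: "(\<lambda>n. fst (h n)) \<longlonglongrightarrow> fst l" and limt: "(\<lambda>n. snd (h n)) \<longlonglongrightarrow> snd l"
    using lim by (auto intro: tendsto_fst tendsto_snd)
  obtain K where K: "0 < K" "\<And>n. norm (snd (h n)) \<le> K"
    using convergent_imp_Bseq[OF convergentI[OF limt]] unfolding Bseq_def by blast
  define c where "c = 2 * r * (K + norm b * norm w)"
  define d where "d = 2 * r * norm b"
  have c0: "0 \<le> c" and d0: "0 \<le> d" using r K(1) by (auto simp: c_def d_def)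
  have vb: "norm (v n) \<le> norm w + (c + d + 1)" for n
  proof -
    have "- K \<le> prox_objective b r w (v n)" using v K(2)[of n] by (smt (verit) real_norm_def)
    moreover have "b \<bullet> fst (v n) \<le> norm b * (norm w + norm (v n - w))"
    proof -
      have "b \<bullet> fst (v n) \<le> norm b * norm (fst (v n))" by (rule norm_cauchy_schwarz)
      also have "norm (fst (v n)) \<le> norm w + norm (v n - w)"
        using norm_fst_le[of "fst (v n)" "snd (v n)"] norm_triangle_sub[of "v n" w] by simp
      then have "norm b * norm (fst (v n)) \<le> norm b * (norm w + norm (v n - w))"
        by (intro mult_left_mono) auto
      finally show ?thesis .
    qed
    ultimately have "(norm (v n - w))\<^sup>2 / (2 * r) \<le> K + norm b * (norm w + norm (v n - w))"
      by (simp add: prox_objective_def)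
    then have "(norm (v n - w))\<^sup>2 \<le> c + d * norm (v n - w)"
      using r by (simp add: c_def d_def pos_divide_le_eq algebra_simps)
    then have "norm (v n - w) \<le> c + d + 1" by (rule quadratic_bound_imp_le[OF _ c0 d0])
    then show ?thesis using norm_triangle_sub[of "v n" w] by simp
  qed
  then have "bounded (range v)" unfolding bounded_iff by blast
  then obtain u \<rho> where rho: "strict_mono \<rho>" and u: "(v \<circ> \<rho>) \<longlonglongrightarrow> u"
    using bounded_imp_convergent_subsequence by blast
  have u': "(\<lambda>n. v (\<rho> n)) \<longlonglongrightarrow> u" using u by (simp add: o_def)
  have "snd u \<in> psd_cone"
    by (rule closed_sequentially[OF closed_psd _ tendsto_snd[OF u']]) (simp add: v)
  moreover have "fst l = C - (sdp_adj A (fst u) + snd u)"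
  proof (rule LIMSEQ_unique)
    show "(\<lambda>n. fst (h (\<rho> n))) \<longlonglongrightarrow> fst l"
      using LIMSEQ_subseq_LIMSEQ[OF limU rho] by (simp add: o_def)
    have "(\<lambda>n. C - (sdp_adj A (fst (v (\<rho> n))) + snd (v (\<rho> n)))) \<longlonglongrightarrow> C - (sdp_adj A (fst u) + snd u)"
      unfolding sdp_adj_def by (intro tendsto_intros u')
    then show "(\<lambda>n. fst (h (\<rho> n))) \<longlonglongrightarrow> C - (sdp_adj A (fst u) + snd u)" by (simp add: v)
  qed
  moreover have "snd l \<le> prox_objective b r w u"
  proof (rule LIMSEQ_le)
    show "(\<lambda>n. snd (h (\<rho> n))) \<longlonglongrightarrow> snd l"
      using LIMSEQ_subseq_LIMSEQ[OF limt rho] by (simp add: o_def)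
    show "(\<lambda>n. prox_objective b r w (v (\<rho> n))) \<longlonglongrightarrow> prox_objective b r w u"
      unfolding prox_objective_def using r by (intro tendsto_intros u') auto
    show "\<exists>N. \<forall>n\<ge>N. snd (h (\<rho> n)) \<le> prox_objective b r w (v (\<rho> n))" using v by blast
  qed
  ultimately show "l \<in> ?H" by blast
qed

lemma prox_objective_concave:
  fixes b :: "real ^ 'm::finite"
  assumes r: "0 < r" and s: "0 \<le> s" "0 \<le> t" "s + t = 1"
  shows "s * prox_objective b r w u + t * prox_objective b r w v
    \<le> prox_objective b r w (s *\<^sub>R u + t *\<^sub>R v)"
proof -
  have t: "t = 1 - s" using s(3) by simp
  define x y where "x = u - w" and "y = v - w"
  have "s *\<^sub>R u + t *\<^sub>R v - w = s *\<^sub>R x + t *\<^sub>R y"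
    by (simp add: x_def y_def t algebra_simps)
  moreover have "s * (norm x)\<^sup>2 + t * (norm y)\<^sup>2 - (norm (s *\<^sub>R x + t *\<^sub>R y))\<^sup>2 = s * t * (norm (x - y))\<^sup>2"
    unfolding t power2_norm_eq_inner
    by (simp add: inner_add_left inner_add_right inner_diff_left inner_diff_right inner_commute
        algebra_simps)
  moreover have "0 \<le> s * t * (norm (x - y))\<^sup>2" using s by simp
  ultimately have "(norm (s *\<^sub>R u + t *\<^sub>R v - w))\<^sup>2 \<le> s * (norm (u - w))\<^sup>2 + t * (norm (v - w))\<^sup>2"
    unfolding x_def[symmetric] y_def[symmetric] by simp
  then have "(norm (s *\<^sub>R u + t *\<^sub>R v - w))\<^sup>2 / (2 * r) \<le> (s * (norm (u - w))\<^sup>2 + t * (norm (v - w))\<^sup>2) / (2 * r)"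
    using r by (intro divide_right_mono) auto
  then show ?thesis
    by (simp add: prox_objective_def inner_add_right right_diff_distrib add_divide_distrib)
qed

lemma convex_prox_hypograph:
  fixes b :: "real ^ 'm::finite" and C :: "real ^ 'n ^ 'n"
  assumes r: "0 < r"
  shows "convex {h. \<exists>v. snd v \<in> psd_cone \<and> fst h = C - (sdp_adj A (fst v) + snd v) \<and>
      snd h \<le> prox_objective b r w v}"
    (is "convex ?H")
proof (rule convexI)
  fix h h' :: "(real ^ 'n ^ 'n) \<times> real" and s t :: real
  assume h: "h \<in> ?H" "h' \<in> ?H" and s: "0 \<le> s" "0 \<le> t" "s + t = 1"
  obtain v where v: "snd v \<in> psd_cone" "fst h = C - (sdp_adj A (fst v) + snd v)"
      "snd h \<le> prox_objective b r w v"
    using h(1) by blast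
  obtain v' where v': "snd v' \<in> psd_cone" "fst h' = C - (sdp_adj A (fst v') + snd v')"
      "snd h' \<le> prox_objective b r w v'"
    using h(2) by blast
  let ?v = "s *\<^sub>R v + t *\<^sub>R v'"
  have "snd ?v \<in> psd_cone" using v(1) v'(1) s by (simp add: psd_add psd_scale)
  moreover have "fst (s *\<^sub>R h + t *\<^sub>R h') = C - (sdp_adj A (fst ?v) + snd ?v)"
  proof -
    have "fst (s *\<^sub>R h + t *\<^sub>R h') = (s + t) *\<^sub>R C - (sdp_adj A (fst ?v) + snd ?v)"
      by (simp add: v(2) v'(2) linear_add[OF linear_sdp_adj] linear_scale[OF linear_sdp_adj]
          algebra_simps)
    then show ?thesis by (simp add: s(3))
  qed
  moreover have "snd (s *\<^sub>R h + t *\<^sub>R h') \<le> prox_objective b r w ?v"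
  proof -
    have "snd (s *\<^sub>R h + t *\<^sub>R h') \<le> s * prox_objective b r w v + t * prox_objective b r w v'"
      using v(3) v'(3) s by (simp add: add_mono mult_left_mono)
    also have "\<dots> \<le> prox_objective b r w ?v" by (rule prox_objective_concave[OF r s])
    finally show ?thesis .
  qed
  ultimately show "s *\<^sub>R h + t *\<^sub>R h' \<in> ?H" by blast
qed

lemma symmetric_part:
  assumes "X \<in> sym_mats"
  shows "(1 / 2) *\<^sub>R (Y + transpose Y) \<in> sym_mats" "((1 / 2) *\<^sub>R (Y + transpose Y)) \<bullet> X = Y \<bullet> X"
proof -
  show "(1 / 2) *\<^sub>R (Y + transpose Y) \<in> sym_mats"
    by (simp add: sym_mats_def transpose_add transpose_scalar add.commute)
  have "transpose Y \<bullet> X = Y \<bullet> X"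
    using assms inner_transpose[of Y X] by (simp add: sym_mats_def)
  then show "((1 / 2) *\<^sub>R (Y + transpose Y)) \<bullet> X = Y \<bullet> X" by (simp add: inner_add_left)
qed

context optimal_pair
begin

lemma dual_feasible_nonempty: "dual_feasible C A \<noteq> {}"
  using Zs_psd ws_adj by (auto simp: dual_feasible_def)

text \<open>
  The point \<open>(0, m + e)\<close> lies above the closed convex hypograph of the value function, whose
  value at \<open>0\<close> is \<open>m\<close>. The slope of a separating hyperplane, symmetrized, is the
  required \<open>X\<close>: the inequality for all perturbations contains in particular the
  perturbation caused by the multiplier update of \<open>X\<close>, where the left-hand side is the
  augmented Lagrangian.
\<close>

lemma subproblem_no_gap:
  assumes r: "0 < r" and e: "0 < e"
  shows "\<exists>X\<in>sym_mats. aug_lagrangian C A b r X w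
    \<le> prox_objective b r w (prox_step C A b r w) + e"
proof -
  define p where "p = prox_step C A b r w"
  define m where "m = prox_objective b r w p"
  let ?H = "{h. \<exists>v. snd v \<in> psd_cone \<and> fst h = C - (sdp_adj A (fst v) + snd v) \<and>
      snd h \<le> prox_objective b r w v}"
  have p: "p \<in> dual_feasible C A" unfolding p_def by (rule prox_step_feasible[OF dual_feasible_nonempty])
  have max: "prox_objective b r w u \<le> m" if "u \<in> dual_feasible C A" for u
  proof -
    have "0 \<le> (norm (u - p))\<^sup>2 / (2 * r)" using r by simp
    then show ?thesis using prox_step_optimal[OF r that p_def] by (simp add: m_def)
  qed
  have "(0, m + e) \<notin> ?H"
  proof
    assume "(0, m + e) \<in> ?H"
    then obtain v where v: "snd v \<in> psd_cone" "C = sdp_adj A (fst v) + snd v"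
        "m + e \<le> prox_objective b r w v" by auto
    then have "v \<in> dual_feasible C A" by (cases v) (simp add: dual_feasible_def)
    with max[of v] v(3) e show False by simp
  qed
  from separating_hyperplane_closed_point[OF convex_prox_hypograph[OF r] closed_prox_hypograph[OF r] this]
  obtain a \<beta> where sep: "a \<bullet> (0, m + e) < \<beta>" and sep': "\<forall>h\<in>?H. \<beta> < a \<bullet> h"
    by (elim exE conjE)
  obtain Y s where a: "a = (Y, s)" by (cases a)
  have sep1: "s * (m + e) < \<beta>" using sep by (simp add: a)
  have sep2: "\<beta> < Y \<bullet> (C - (sdp_adj A (fst v) + snd v)) + s * prox_objective b r w v"
    if "snd v \<in> psd_cone" for v
  proof -
    have "(C - (sdp_adj A (fst v) + snd v), prox_objective b r w v) \<in> ?H"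
      using that by (intro CollectI exI[of _ v]) simp
    from bspec[OF sep' this] show ?thesis by (simp add: a)
  qed
  \<comment> \<open>The hyperplane is not vertical, since \<open>p\<close> puts a point of the hypograph at \<open>U = 0\<close>.\<close>
  have s: "s < 0"
  proof -
    have "snd p \<in> psd_cone" "sdp_adj A (fst p) + snd p = C"
      using p by (auto simp: dual_feasible_def)
    then have "s * (m + e) < s * m" using sep1 sep2[of p] by (simp add: m_def)
    then have "s * e < 0" by (simp add: distrib_left)
    then show ?thesis using e by (simp add: mult_less_0_iff)
  qed
  define X where "X = (1 / s) *\<^sub>R ((1 / 2) *\<^sub>R (Y + transpose Y))"
  have X: "X \<in> sym_mats"
    unfolding X_def by (intro subspace_mul[OF subspace_sym_mats] symmetric_part(1)[OF C_sym])
  have XY: "X \<bullet> U = (Y \<bullet> U) / s" if "U \<in> sym_mats" for U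
    using symmetric_part(2)[OF that, of Y] by (simp add: X_def)
  define v where "v = alm_update A b r X w"
  have v: "snd v \<in> psd_cone"
    by (cases w) (simp add: v_def alm_update_def proj_psd_in)
  let ?U = "C - (sdp_adj A (fst v) + snd v)"
  have U: "?U \<in> sym_mats"
    by (intro subspace_diff subspace_add subspace_sym_mats C_sym adj_sym psd_sym[OF v])
  have "s * (m + e) < Y \<bullet> ?U + s * prox_objective b r w v" using sep1 sep2[OF v] by simp
  also have "\<dots> = s * (X \<bullet> ?U + prox_objective b r w v)"
    using s by (simp add: XY[OF U] distrib_left)
  finally have "X \<bullet> ?U + prox_objective b r w v < m + e"
    using s by (simp add: mult_less_cancel_left)
  moreover have "aug_lagrangian C A b r X w = X \<bullet> ?U + prox_objective b r w v"
  proof -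
    have "X \<bullet> ?U = C \<bullet> X - fst v \<bullet> sdp_op A X - snd v \<bullet> X"
      using sdp_adjoint[of A "fst v" X] by (simp add: inner_diff_right inner_add_right inner_commute)
    then show ?thesis
      unfolding aug_lagrangian_as_lagrangian[OF r v_def] prox_objective_def
      by (simp add: inner_diff_right inner_commute)
  qed
  ultimately show ?thesis using X unfolding m_def p_def by (intro bexI[of _ X]) auto
qed

lemma subproblem_value_le:
  assumes r: "0 < r"
  shows "(INF X\<in>sym_mats. aug_lagrangian C A b r X w) \<le> prox_objective b r w (prox_step C A b r w)"
proof (rule field_le_epsilon)
  fix e :: real assume "0 < e"
  then obtain X where X: "X \<in> sym_mats"
      "aug_lagrangian C A b r X w \<le> prox_objective b r w (prox_step C A b r w) + e"
    using subproblem_no_gap[OF r] by blast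
  have "prox_objective b r w (prox_step C A b r w) \<le> aug_lagrangian C A b r Y w" for Y
  proof -
    have "0 \<le> (norm (prox_step C A b r w - alm_update A b r Y w))\<^sup>2 / (2 * r)" using r by simp
    then show ?thesis
      using aug_lagrangian_ge[OF r prox_step_feasible[OF dual_feasible_nonempty, of b r w] refl,
          where X = Y and w = w and b = b]
      by linarith
  qed
  then have "bdd_below ((\<lambda>X. aug_lagrangian C A b r X w) ` sym_mats)" by (intro bdd_belowI2)
  then have "(INF X\<in>sym_mats. aug_lagrangian C A b r X w) \<le> aug_lagrangian C A b r X w"
    by (rule cINF_lower) (rule X(1))
  with X(2) show "(INF X\<in>sym_mats. aug_lagrangian C A b r X w)
      \<le> prox_objective b r w (prox_step C A b r w) + e"
    by simp
qed

lemma alm_update_near_prox: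
  assumes r: "0 < r"
  shows "(norm (alm_update A b r X w - prox_step C A b r w))\<^sup>2
    \<le> 2 * r * subproblem_gap C A b r X w"
proof -
  have "(norm (prox_step C A b r w - alm_update A b r X w))\<^sup>2 / (2 * r)
      \<le> subproblem_gap C A b r X w"
    using aug_lagrangian_ge[OF r prox_step_feasible[OF dual_feasible_nonempty, of b r w] refl,
        where X = X and w = w and b = b]
      subproblem_value_le[OF r, of w]
    by (simp add: subproblem_gap_def)
  then show ?thesis using r by (simp add: pos_divide_le_eq norm_minus_commute mult.commute)
qed

text \<open>
  At a solution the dual objective equals \<open>pval\<close>, so the optimality inequality of the proximal
  step becomes a decrease of the squared distance to that solution.
\<close>

lemma prox_step_fejer:
  assumes r: "0 < r" and u: "u \<in> dual_solutions C A b" and p: "p = prox_step C A b r w"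
  shows "(norm (p - u))\<^sup>2 + (norm (p - w))\<^sup>2 + 2 * r * (pval - b \<bullet> fst p) \<le> (norm (w - u))\<^sup>2"
proof -
  have uf: "u \<in> dual_feasible C A" "b \<bullet> fst u = pval"
    using u duality by (auto simp: dual_solutions_def strong_duality_def)
  have "pval - b \<bullet> fst p \<le> ((norm (u - w))\<^sup>2 - (norm (u - p))\<^sup>2 - (norm (p - w))\<^sup>2) / (2 * r)"
    using prox_step_optimal[OF r uf(1) p]
    by (simp add: prox_objective_def uf(2) diff_divide_distrib)
  then have "2 * r * (pval - b \<bullet> fst p) \<le> (norm (u - w))\<^sup>2 - (norm (u - p))\<^sup>2 - (norm (p - w))\<^sup>2"
    using r by (simp add: pos_le_divide_eq mult.commute)
  then show ?thesis by (simp add: norm_minus_commute)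
qed

lemma prox_step_dual_value_le: "b \<bullet> fst (prox_step C A b r w) \<le> pval"
  using prox_step_feasible[OF dual_feasible_nonempty, of b r w] dual_value_le
  by (cases "prox_step C A b r w") simp

lemma closed_dual_solutions: "closed (dual_solutions C A b)"
proof -
  have "dual_solutions C A b = dual_feasible C A \<inter> {w. snd w \<bullet> Xs = 0}"
    by (auto simp: dual_solutions_iff)
  also have "closed \<dots>"
    by (intro closed_Int closed_dual_feasible closed_Collect_eq continuous_intros)
  finally show ?thesis .
qed

text \<open>
  By Moreau's decomposition \<open>Z - r X\<close> is the new \<open>Z\<close> minus a positive semidefinite
  matrix. Solving for \<open>X\<close> exhibits a positive semidefinite matrix at distance
  \<open>|v - w| / r\<close> at most.
\<close>

lemma alm_residuals:
  assumes r: "0 < r" and X: "X \<in> sym_mats" and Z: "snd w \<in> sym_mats" and v: "v = alm_update A b r X w"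
  shows "infdist X psd_cone \<le> norm (v - w) / r" "norm (sdp_op A X - b) \<le> norm (v - w) / r"
proof -
  obtain y Z where w: "w = (y, Z)" by (cases w)
  define p where "p = proj_psd (Z - r *\<^sub>R X)"
  have v': "v = (y + r *\<^sub>R (b - sdp_op A X), p)" by (simp add: v w alm_update_def p_def)
  have "Z - r *\<^sub>R X \<in> sym_mats"
    using Z X by (intro subspace_diff subspace_mul subspace_sym_mats) (auto simp: w)
  then have "p - (Z - r *\<^sub>R X) \<in> psd_cone" unfolding p_def by (rule proj_psd_diff_psd)
  then have "(1 / r) *\<^sub>R (p - (Z - r *\<^sub>R X)) \<in> psd_cone" using r by (intro psd_scale) auto
  moreover have "X - (1 / r) *\<^sub>R (p - (Z - r *\<^sub>R X)) = (1 / r) *\<^sub>R (Z - p)"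
    using r by (simp add: algebra_simps)
  ultimately have "infdist X psd_cone \<le> norm ((1 / r) *\<^sub>R (Z - p))"
    by (metis dist_norm infdist_le)
  also have "\<dots> = norm (p - Z) / r" using r by (simp add: norm_minus_commute)
  also have "\<dots> \<le> norm (v - w) / r"
    using r norm_snd_le[of "p - Z" "fst v - y"] by (intro divide_right_mono) (auto simp: v' w)
  finally show "infdist X psd_cone \<le> norm (v - w) / r" .
  have "r * norm (sdp_op A X - b) = norm (r *\<^sub>R (b - sdp_op A X))"
    using r by (simp add: norm_minus_commute)
  also have "\<dots> \<le> norm (v - w)"
    using norm_fst_le[of "r *\<^sub>R (b - sdp_op A X)" "p - Z"] by (simp add: v' w)
  finally show "norm (sdp_op A X - b) \<le> norm (v - w) / r"
    using r by (simp add: pos_le_divide_eq mult.commute)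
qed

text \<open>
  The augmented Lagrangian is the objective plus the change of the squared multiplier norm, and by
  the absence of a gap it exceeds the value of the proximal problem, hence \<open>pval\<close>, by at
  most the suboptimality.
\<close>

lemma alm_value_bound:
  assumes r: "0 < r" and v: "v = alm_update A b r X w"
  shows "C \<bullet> X - pval \<le> ((norm w)\<^sup>2 - (norm v)\<^sup>2) / (2 * r) + subproblem_gap C A b r X w"
proof -
  have "aug_lagrangian C A b r X w \<le> prox_objective b r w (prox_step C A b r w) + subproblem_gap C A b r X w"
    using subproblem_value_le[OF r, of w] by (simp add: subproblem_gap_def)
  moreover have "0 \<le> (norm (prox_step C A b r w - w))\<^sup>2 / (2 * r)" using r by simp
  then have "prox_objective b r w (prox_step C A b r w) \<le> pval"
    using prox_step_dual_value_le[of r w] by (simp add: prox_objective_def)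
  ultimately show ?thesis
    unfolding aug_lagrangian_eq[OF r] v[symmetric] by (simp add: diff_divide_distrib)
qed

end

section \<open>Linear convergence\<close>

theorem theorem3:
  fixes C :: "real ^ 'n ^ 'n" and A :: "'m::finite \<Rightarrow> real ^ 'n ^ 'n" and b :: "real ^ 'm"
    and r \<epsilon> \<delta> :: "nat \<Rightarrow> real" and r_inf :: real
    and X :: "nat \<Rightarrow> real ^ 'n ^ 'n" and w :: "nat \<Rightarrow> (real ^ 'm) \<times> (real ^ 'n ^ 'n)"
  assumes "sdp_data C A"
    and "strong_duality C A b"
    and "dual_strict_complementarity C A b"
    and "\<forall>k. 0 < r k" and "incseq r" and "r \<longlonglongrightarrow> r_inf"
    and "alm_sequence A b r X w"
    and "criterion_A C A b r \<epsilon> X w"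
    and "criterion_B C A b r \<delta> X w"
  shows "(\<exists>k0>0. \<exists>\<mu> \<mu>' \<mu>'' :: nat \<Rightarrow> real.
            (\<forall>k\<ge>k0. 0 < \<mu> k \<and> \<mu> k < 1 \<and> 0 < \<mu>' k \<and> 0 < \<mu>'' k \<and>
               infdist (w (Suc k)) (dual_solutions C A b)
                 \<le> \<mu> k * infdist (w k) (dual_solutions C A b) \<and>
               infdist (X (Suc k)) psd_cone \<le> \<mu>' k * infdist (w k) (dual_solutions C A b) \<and>
               norm (sdp_op A (X (Suc k)) - b) \<le> \<mu>' k * infdist (w k) (dual_solutions C A b) \<and>
               C \<bullet> X (Suc k) - primal_value C A b
                 \<le> \<mu>'' k * infdist (w k) (dual_solutions C A b)) \<and>
            (\<exists>q<1. \<exists>M. \<forall>k\<ge>k0. \<mu> k \<le> q \<and> \<mu>' k \<le> M \<and> \<mu>'' k \<le> M))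
       \<and> (bounded (primal_solutions C A b) \<longrightarrow>
          (\<exists>k0>0. \<exists>\<tau> :: nat \<Rightarrow> real.
             (\<forall>k\<ge>k0. 0 < \<tau> k \<and>
                (infdist (X (Suc k)) (primal_solutions C A b))\<^sup>2
                  \<le> \<tau> k * infdist (w k) (dual_solutions C A b)) \<and>
             (\<exists>M. \<forall>k\<ge>k0. \<tau> k \<le> M)))"
proof -
  obtain Xs ys Zs where Xs: "Xs \<in> primal_solutions C A b" and ws: "(ys, Zs) \<in> dual_solutions C A b"
    and ri: "Xs \<in> rel_interior (normal_cone (polar_cone psd_cone) (- Zs))"
    using assms(3) unfolding dual_strict_complementarity_def by (elim exE conjE)
  interpret optimal_pair C A b Xs ys Zs
    by unfold_locales (use assms(1,2) Xs ws in auto)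
  obtain P t l where P: "P \<in> sym_mats" "P ** P = P" "Zs ** P = 0" "Xs ** (mat 1 - P) = 0"
    and t: "0 < t" "Xs - t *\<^sub>R P \<in> psd_cone"
    and l: "0 < l" "Zs - l *\<^sub>R (mat 1 - P) \<in> psd_cone"
    by (rule strict_complementarity_projector[OF Zs_psd ri])
  let ?D = "dual_solutions C A b"
  define p where "p k = prox_step C A b (r k) (w k)" for k
  define d where "d k = infdist (w k) ?D" for k
  define \<Delta> where "\<Delta> k = norm (w (Suc k) - w k)" for k
  have r: "0 < r k" for k using assms(4) by blast
  have r_ge: "r 0 \<le> r k" for k using assms(5) by (rule incseqD) simp
  have X_sym: "X (Suc k) \<in> sym_mats" and w_Suc: "w (Suc k) = alm_update A b (r k) (X (Suc k)) (w k)" for k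
    using assms(7) by (auto simp: alm_sequence_def)
  have w_psd: "snd (w k) \<in> psd_cone" for k
  proof (cases k)
    case 0
    then show ?thesis using assms(7) by (simp add: alm_sequence_def)
  next
    case (Suc j)
    then show ?thesis using w_Suc[of j] by (cases "w j") (simp add: alm_update_def proj_psd_in)
  qed
  have \<epsilon>: "0 \<le> \<epsilon> k" "summable \<epsilon>"
      "subproblem_gap C A b (r k) (X (Suc k)) (w k) \<le> (\<epsilon> k)\<^sup>2 / (2 * r k)" for k
    using assms(8) by (auto simp: criterion_A_def)
  have \<delta>: "0 \<le> \<delta> k" "summable \<delta>"
      "subproblem_gap C A b (r k) (X (Suc k)) (w k) \<le> (\<delta> k)\<^sup>2 * (\<Delta> k)\<^sup>2 / (2 * r k)" for k
    using assms(9) by (auto simp: criterion_B_def \<Delta>_def)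
  have near: "norm (w (Suc k) - p k) \<le> c"
    if "subproblem_gap C A b (r k) (X (Suc k)) (w k) \<le> c\<^sup>2 / (2 * r k)" "0 \<le> c" for k c
  proof (rule power2_le_imp_le[OF _ that(2)])
    have "(norm (w (Suc k) - p k))\<^sup>2 \<le> 2 * r k * subproblem_gap C A b (r k) (X (Suc k)) (w k)"
      unfolding w_Suc[of k] p_def by (rule alm_update_near_prox[OF r])
    also have "\<dots> \<le> 2 * r k * (c\<^sup>2 / (2 * r k))"
      using r[of k] by (intro mult_left_mono that(1)) simp
    also have "\<dots> = c\<^sup>2" using r[of k] by simp
    finally show "(norm (w (Suc k) - p k))\<^sup>2 \<le> c\<^sup>2" .
  qed
  have near_A: "norm (w (Suc k) - p k) \<le> \<epsilon> k" for k by (rule near[OF \<epsilon>(3,1)])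
  have near_B: "norm (w (Suc k) - p k) \<le> \<delta> k * \<Delta> k" for k
  proof (rule near)
    show "subproblem_gap C A b (r k) (X (Suc k)) (w k) \<le> (\<delta> k * \<Delta> k)\<^sup>2 / (2 * r k)"
      using \<delta>(3)[of k] by (simp add: power_mult_distrib)
    show "0 \<le> \<delta> k * \<Delta> k" using \<delta>(1)[of k] by (simp add: \<Delta>_def)
  qed

  have fejer: "(norm (p k - u))\<^sup>2 + (norm (p k - w k))\<^sup>2 + 2 * r k * (pval - b \<bullet> fst (p k)) \<le> (norm (w k - u))\<^sup>2"
    if "u \<in> ?D" for k u
    by (rule prox_step_fejer[OF r that p_def])
  have gap0: "0 \<le> pval - b \<bullet> fst (p k)" for k
    using prox_step_dual_value_le[of "r k" "w k"] by (simp add: p_def)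
  have rgap0: "0 \<le> 2 * r k * (pval - b \<bullet> fst (p k))" for k
    using gap0[of k] r[of k] by simp
  have p_closer: "norm (p k - u) \<le> norm (w k - u)" and p_step: "norm (p k - w k) \<le> norm (w k - u)"
    if "u \<in> ?D" for k u
  proof -
    show "norm (p k - u) \<le> norm (w k - u)"
    proof (rule power2_le_imp_le)
      show "(norm (p k - u))\<^sup>2 \<le> (norm (w k - u))\<^sup>2"
        using fejer[OF that, of k] rgap0[of k] zero_le_power2[of "norm (p k - w k)"] by linarith
    qed simp
    show "norm (p k - w k) \<le> norm (w k - u)"
    proof (rule power2_le_imp_le)
      show "(norm (p k - w k))\<^sup>2 \<le> (norm (w k - u))\<^sup>2"
        using fejer[OF that, of k] rgap0[of k] zero_le_power2[of "norm (p k - u)"] by linarith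
    qed simp
  qed

  \<comment> \<open>The exact steps approach every solution and the errors are summable, so the multipliers
      stay within \<open>B\<close> of one fixed solution, and one growth constant serves for all steps.\<close>
  define B where "B = norm (w 0 - (ys, Zs)) + suminf \<epsilon>"
  have w_partial: "norm (w k - (ys, Zs)) \<le> norm (w 0 - (ys, Zs)) + (\<Sum>i<k. \<epsilon> i)" for k
  proof (induction k)
    case (Suc k)
    have "norm (w (Suc k) - (ys, Zs)) \<le> norm (w (Suc k) - p k) + norm (p k - (ys, Zs))"
      using dist_triangle[of "w (Suc k)" "(ys, Zs)" "p k"] unfolding dist_norm .
    then show ?case using near_A[of k] p_closer[OF ws, of k] Suc by simp
  qed simp
  have wB: "norm (w k - (ys, Zs)) \<le> B" for k
    using w_partial[of k] sum_le_suminf[OF \<epsilon>(2), of "{..<k}"] \<epsilon>(1) by (simp add: B_def)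
  have B0: "0 \<le> B" using order_trans[OF norm_ge_zero wB[of 0]] .

  obtain \<kappa> where \<kappa>: "0 < \<kappa>"
    and growth: "\<And>y Z. (y, Z) \<in> dual_feasible C A \<Longrightarrow> norm ((y, Z) - (ys, Zs)) \<le> B \<Longrightarrow>
       (infdist (y, Z) ?D)\<^sup>2 \<le> \<kappa> * (pval - b \<bullet> y)"
    by (rule dual_quadratic_growth[OF P t l, of B]) auto
  have p_growth: "(infdist (p k) ?D)\<^sup>2 \<le> \<kappa> * (pval - b \<bullet> fst (p k))" for k
  proof -
    have "p k \<in> dual_feasible C A" unfolding p_def by (rule prox_step_feasible[OF dual_feasible_nonempty])
    moreover have "norm (p k - (ys, Zs)) \<le> B" using p_closer[OF ws, of k] wB[of k] by linarith
    ultimately show ?thesis using growth[of "fst (p k)" "snd (p k)"] by simp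
  qed
  \<comment> \<open>Growth and the decrease of the squared distance give
      \<open>(1 + a) dist(p)^2 \<le> dist(w)^2\<close> for the exact step \<open>p\<close> from \<open>w\<close>.\<close>
  define a where "a = 2 * r 0 / \<kappa>"
  define q0 where "q0 = sqrt (1 / (1 + a))"
  have r0k: "0 < a" using r \<kappa> by (simp add: a_def)
  then have q0: "0 < q0" "q0 < 1" by (simp_all add: q0_def add_pos_pos)
  have d0: "0 \<le> d k" for k by (simp add: d_def infdist_nonneg)
  have contraction: "infdist (p k) ?D \<le> q0 * d k" and p_near: "norm (p k - w k) \<le> d k" for k
  proof -
    obtain u where u: "u \<in> ?D" "d k = dist (w k) u"
      unfolding d_def by (rule infdist_attains_inf[OF closed_dual_solutions, of "w k"]) (use ws in auto)
    then show "norm (p k - w k) \<le> d k" using p_step[OF u(1), of k] by (simp add: dist_norm)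
    let ?x = "infdist (p k) ?D"
    have "?x\<^sup>2 \<le> (norm (p k - u))\<^sup>2"
      using infdist_le[OF u(1), of "p k"] by (intro power_mono infdist_nonneg) (simp add: dist_norm)
    moreover have "a * ?x\<^sup>2 \<le> 2 * r k * (pval - b \<bullet> fst (p k))"
    proof -
      have "a * ?x\<^sup>2 \<le> a * (\<kappa> * (pval - b \<bullet> fst (p k)))"
        using r0k by (intro mult_left_mono p_growth) simp
      also have "\<dots> = 2 * r 0 * (pval - b \<bullet> fst (p k))" using \<kappa> by (simp add: a_def)
      also have "\<dots> \<le> 2 * r k * (pval - b \<bullet> fst (p k))"
        using r_ge[of k] gap0[of k] by (intro mult_right_mono) auto
      finally show ?thesis .
    qed
    ultimately have "(1 + a) * ?x\<^sup>2 \<le> (d k)\<^sup>2"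
      using fejer[OF u(1), of k] zero_le_power2[of "norm (p k - w k)"]
      unfolding distrib_right u(2) dist_norm by linarith
    then have "?x\<^sup>2 \<le> 1 / (1 + a) * (d k)\<^sup>2"
      using r0k by (simp add: pos_le_divide_eq mult.commute)
    also have "\<dots> = (q0 * d k)\<^sup>2"
      using r0k by (simp add: q0_def power_mult_distrib)
    finally show "?x \<le> q0 * d k"
      by (rule power2_le_imp_le) (use q0 d0[of k] in simp)
  qed

  \<comment> \<open>A relative error below \<open>1 / 2\<close> bounds the step by \<open>2 d\<close>; one below \<open>(1 - q0) / 4\<close> then costs
      at most half of the margin between the exact rate \<open>q0\<close> and \<open>1\<close>.\<close>
  define c where "c = min (1 / 2) ((1 - q0) / 4)"
  have c: "0 < c" "c \<le> 1 / 2" "c \<le> (1 - q0) / 4" using q0 by (auto simp: c_def)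
  have "\<forall>\<^sub>F k in sequentially. \<delta> k < c"
    using summable_LIMSEQ_zero[OF \<delta>(2)] c(1) by (rule order_tendstoD(2))
  then obtain k1 where k1: "\<And>k. k1 \<le> k \<Longrightarrow> \<delta> k < c"
    unfolding eventually_sequentially by blast
  define k0 where "k0 = Suc k1"
  have k0: "\<delta> k < c" if "k0 \<le> k" for k using k1[of k] that by (simp add: k0_def)
  have \<Delta>0: "0 \<le> \<Delta> k" for k by (simp add: \<Delta>_def)
  have step: "\<Delta> k \<le> 2 * d k" if "k0 \<le> k" for k
  proof -
    have "\<Delta> k \<le> norm (w (Suc k) - p k) + norm (p k - w k)"
      unfolding \<Delta>_def using norm_triangle_ineq[of "w (Suc k) - p k" "p k - w k"] by simp
    moreover have "\<delta> k * \<Delta> k \<le> 1 / 2 * \<Delta> k"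
      using k0[OF that] c(2) \<Delta>0 by (intro mult_right_mono) auto
    ultimately show ?thesis using near_B[of k] p_near[of k] by linarith
  qed
  define q where "q = (1 + q0) / 2"
  have q: "0 < q" "q < 1" using q0 by (auto simp: q_def)
  have rate: "infdist (w (Suc k)) ?D \<le> q * d k" if "k0 \<le> k" for k
  proof -
    have "\<delta> k * \<Delta> k \<le> (1 - q0) / 4 * (2 * d k)"
      using k0[OF that] c(3) step[OF that] \<Delta>0[of k] q0 by (intro mult_mono) auto
    also have "\<dots> = (1 - q0) / 2 * d k" by simp
    finally have "norm (w (Suc k) - p k) \<le> (1 - q0) / 2 * d k" using near_B[of k] by linarith
    moreover have "infdist (w (Suc k)) ?D \<le> infdist (p k) ?D + norm (w (Suc k) - p k)"
      using infdist_triangle[of "w (Suc k)" ?D "p k"] by (simp add: dist_norm)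
    ultimately have "infdist (w (Suc k)) ?D \<le> q0 * d k + (1 - q0) / 2 * d k"
      using contraction[of k] by linarith
    also have "\<dots> = q * d k" by (simp add: q_def field_simps)
    finally show ?thesis .
  qed

  define M1 where "M1 = 2 / r 0"
  have M1: "0 < M1" using r by (simp add: M1_def)
  have step_r: "\<Delta> k / r k \<le> M1 * d k" if "k0 \<le> k" for k
  proof -
    have "\<Delta> k / r k \<le> 2 * d k / r 0"
      using step[OF that] d0[of k] r r_ge by (intro frac_le) auto
    then show ?thesis by (simp add: M1_def)
  qed
  have res: "infdist (X (Suc k)) psd_cone \<le> M1 * d k" "norm (sdp_op A (X (Suc k)) - b) \<le> M1 * d k"
    if "k0 \<le> k" for k
    using alm_residuals[OF r[of k] X_sym[of k] psd_sym[OF w_psd] w_Suc[of k]] step_r[OF that]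
    unfolding \<Delta>_def by (linarith, linarith)
  define N where "N = 4 * B + 2 * norm (ys, Zs)"
  have N0: "0 \<le> N" using B0 by (simp add: N_def)
  define M2 where "M2 = (N + 1) * M1"
  have M2: "0 < M2" using N0 M1 by (simp add: M2_def)
  have val: "C \<bullet> X (Suc k) - pval \<le> M2 * d k" if "k0 \<le> k" for k
  proof -
    have wn: "norm (w j) \<le> B + norm (ys, Zs)" for j
      using wB[of j] norm_triangle_sub[of "w j" "(ys, Zs)"] by linarith
    have "\<Delta> k \<le> 2 * B"
    proof -
      have "\<Delta> k \<le> norm (w (Suc k) - (ys, Zs)) + norm (w k - (ys, Zs))"
        unfolding \<Delta>_def using norm_triangle_ineq4[of "w (Suc k) - (ys, Zs)" "w k - (ys, Zs)"] by simp
      then show ?thesis using wB[of k] wB[of "Suc k"] by linarith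
    qed
    have "(norm (w k))\<^sup>2 - (norm (w (Suc k)))\<^sup>2
        = (norm (w k) - norm (w (Suc k))) * (norm (w k) + norm (w (Suc k)))"
      by (simp add: power2_eq_square algebra_simps)
    also have "\<dots> \<le> \<Delta> k * (2 * B + 2 * norm (ys, Zs))"
    proof (rule mult_mono)
      show "norm (w k) - norm (w (Suc k)) \<le> \<Delta> k"
        unfolding \<Delta>_def by (subst norm_minus_commute) (rule norm_triangle_ineq2)
      show "norm (w k) + norm (w (Suc k)) \<le> 2 * B + 2 * norm (ys, Zs)"
        using wn[of k] wn[of "Suc k"] by linarith
    qed (use \<Delta>0 in auto)
    finally have 1: "(norm (w k))\<^sup>2 - (norm (w (Suc k)))\<^sup>2 \<le> \<Delta> k * (2 * B + 2 * norm (ys, Zs))" .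
    have "(\<delta> k)\<^sup>2 * (\<Delta> k)\<^sup>2 \<le> 1 * (\<Delta> k * (2 * B))"
    proof (rule mult_mono)
      show "(\<delta> k)\<^sup>2 \<le> 1" using k0[OF that] c(2) \<delta>(1)[of k] by (intro power_le_one) auto
      show "(\<Delta> k)\<^sup>2 \<le> \<Delta> k * (2 * B)"
        unfolding power2_eq_square by (intro mult_left_mono \<open>\<Delta> k \<le> 2 * B\<close> \<Delta>0)
    qed auto
    with 1 have "(norm (w k))\<^sup>2 - (norm (w (Suc k)))\<^sup>2 + (\<delta> k)\<^sup>2 * (\<Delta> k)\<^sup>2 \<le> N * \<Delta> k"
      by (simp add: N_def algebra_simps)
    then have "((norm (w k))\<^sup>2 - (norm (w (Suc k)))\<^sup>2 + (\<delta> k)\<^sup>2 * (\<Delta> k)\<^sup>2) / (2 * r k) \<le> N * \<Delta> k / (2 * r k)"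
      using r[of k] by (intro divide_right_mono) auto
    then have "((norm (w k))\<^sup>2 - (norm (w (Suc k)))\<^sup>2) / (2 * r k) + (\<delta> k)\<^sup>2 * (\<Delta> k)\<^sup>2 / (2 * r k)
        \<le> N / 2 * (\<Delta> k / r k)"
      by (simp add: add_divide_distrib)
    also have "\<dots> \<le> (N + 1) * (M1 * d k)"
      using step_r[OF that] N0 \<Delta>0[of k] r[of k] by (intro mult_mono) auto
    finally show ?thesis
      using alm_value_bound[OF r[of k] w_Suc] \<delta>(3)[of k] by (simp add: M2_def mult.assoc)
  qed

  have part_a: "\<exists>k0>0. \<exists>\<mu> \<mu>' \<mu>'' :: nat \<Rightarrow> real.
            (\<forall>k\<ge>k0. 0 < \<mu> k \<and> \<mu> k < 1 \<and> 0 < \<mu>' k \<and> 0 < \<mu>'' k \<and>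
               infdist (w (Suc k)) ?D \<le> \<mu> k * infdist (w k) ?D \<and>
               infdist (X (Suc k)) psd_cone \<le> \<mu>' k * infdist (w k) ?D \<and>
               norm (sdp_op A (X (Suc k)) - b) \<le> \<mu>' k * infdist (w k) ?D \<and>
               C \<bullet> X (Suc k) - pval \<le> \<mu>'' k * infdist (w k) ?D) \<and>
            (\<exists>q<1. \<exists>M. \<forall>k\<ge>k0. \<mu> k \<le> q \<and> \<mu>' k \<le> M \<and> \<mu>'' k \<le> M)"
  proof (rule exI[of _ k0], rule conjI, goal_cases)
    case 1
    show "0 < k0" by (simp add: k0_def)
  next
    case 2
    show ?case
    proof (rule exI[of _ "\<lambda>_. q"], rule exI[of _ "\<lambda>_. M1"], rule exI[of _ "\<lambda>_. M2"],
        rule conjI, goal_cases)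
      case 1
      show ?case using q M1 M2 rate res val by (simp add: d_def)
    next
      case 2
      show ?case using q(2) by (intro exI[of _ q] conjI exI[of _ "max M1 M2"]) simp_all
    qed
  qed

  have part_b: "\<exists>k0>0. \<exists>\<tau> :: nat \<Rightarrow> real.
             (\<forall>k\<ge>k0. 0 < \<tau> k \<and>
                (infdist (X (Suc k)) (primal_solutions C A b))\<^sup>2 \<le> \<tau> k * infdist (w k) ?D) \<and>
             (\<exists>M. \<forall>k\<ge>k0. \<tau> k \<le> M)"
    if bdd: "bounded (primal_solutions C A b)"
  proof -
    obtain K where K: "0 < K" "\<And>Y. norm (sdp_op A Y) \<le> K * norm Y"
      using linear_bounded_pos[OF linear_sdp_op[of A]] by blast
    define M where "M = M1 + K * M1 + M2 + norm C * M1"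
    have M: "0 \<le> M" using M1 M2 K(1) by (simp add: M_def)
    obtain \<tau> where \<tau>: "0 < \<tau>"
      and bound: "\<And>Y \<eta>. 0 \<le> \<eta> \<Longrightarrow> \<eta> \<le> B \<Longrightarrow> Y \<in> psd_cone \<Longrightarrow> norm (sdp_op A Y - b) \<le> M * \<eta> \<Longrightarrow>
       C \<bullet> Y - pval \<le> M * \<eta> \<Longrightarrow> (infdist Y (primal_solutions C A b))\<^sup>2 \<le> \<tau> * \<eta>"
      by (rule primal_error_bound[OF P t l bdd M, of B]) auto
    define T where "T = 2 * \<tau> + 2 * M1\<^sup>2 * B"
    have T: "0 < T" using \<tau> B0 by (simp add: T_def add_pos_nonneg)
    have "(infdist (X (Suc k)) (primal_solutions C A b))\<^sup>2 \<le> T * d k" if k: "k0 \<le> k" for k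
    proof -
      \<comment> \<open>The iterate itself may be indefinite, so the error bound is applied to its projection.\<close>
      define Y where "Y = closest_point psd_cone (X (Suc k))"
      have Y: "Y \<in> psd_cone" unfolding Y_def using proj_psd_in[of "X (Suc k)"] by (simp add: proj_psd_def)
      have XY: "norm (X (Suc k) - Y) \<le> M1 * d k"
      proof -
        obtain V where V: "V \<in> psd_cone" "infdist (X (Suc k)) psd_cone = dist (X (Suc k)) V"
          by (rule infdist_attains_inf[OF closed_psd, of "X (Suc k)"]) (use Y in auto)
        have "dist (X (Suc k)) Y \<le> dist (X (Suc k)) V"
          unfolding Y_def by (rule closest_point_le[OF closed_psd V(1)])
        then show ?thesis using V(2) res(1)[OF k] by (simp add: dist_norm)
      qed
      have dB: "d k \<le> B"
        using infdist_le[OF ws, of "w k"] wB[of k] by (simp add: d_def dist_norm)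
      have Md: "M * d k = M1 * d k + K * (M1 * d k) + M2 * d k + norm C * (M1 * d k)"
        by (simp add: M_def algebra_simps)
      have nonneg: "0 \<le> M1 * d k" "0 \<le> K * (M1 * d k)" "0 \<le> M2 * d k" "0 \<le> norm C * (M1 * d k)"
        using M1 M2 K(1) d0[of k] by simp_all
      have "norm (sdp_op A Y - b) \<le> M * d k"
      proof -
        have "norm (sdp_op A (Y - X (Suc k))) \<le> K * (M1 * d k)"
          using order_trans[OF K(2)[of "Y - X (Suc k)"] mult_left_mono[of _ "M1 * d k" K]] XY K(1)
          by (simp add: norm_minus_commute)
        moreover have "norm (sdp_op A Y - b) \<le> norm (sdp_op A (Y - X (Suc k))) + norm (sdp_op A (X (Suc k)) - b)"
          using norm_triangle_ineq[of "sdp_op A (Y - X (Suc k))" "sdp_op A (X (Suc k)) - b"]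
          by (simp add: linear_diff[OF linear_sdp_op])
        ultimately show ?thesis using res(2)[OF k] nonneg Md by linarith
      qed
      moreover have "C \<bullet> Y - pval \<le> M * d k"
      proof -
        have "C \<bullet> (Y - X (Suc k)) \<le> norm C * norm (Y - X (Suc k))" by (rule norm_cauchy_schwarz)
        also have "\<dots> \<le> norm C * (M1 * d k)"
          using XY by (intro mult_left_mono) (auto simp: norm_minus_commute)
        finally have "C \<bullet> Y - C \<bullet> X (Suc k) \<le> norm C * (M1 * d k)" by (simp add: inner_diff_right)
        then show ?thesis using val[OF k] nonneg Md by linarith
      qed
      ultimately have Yb: "(infdist Y (primal_solutions C A b))\<^sup>2 \<le> \<tau> * d k"
        by (rule bound[OF d0 dB Y])
      let ?x = "infdist Y (primal_solutions C A b)"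
      have "infdist (X (Suc k)) (primal_solutions C A b) \<le> ?x + M1 * d k"
        using infdist_triangle[of "X (Suc k)" "primal_solutions C A b" Y] XY by (simp add: dist_norm)
      then have "(infdist (X (Suc k)) (primal_solutions C A b))\<^sup>2 \<le> (?x + M1 * d k)\<^sup>2"
        by (rule power_mono[OF _ infdist_nonneg])
      also have "\<dots> \<le> 2 * ?x\<^sup>2 + 2 * (M1 * d k)\<^sup>2"
        using zero_le_power2[of "?x - M1 * d k"] by (simp add: power2_eq_square algebra_simps)
      also have "(M1 * d k)\<^sup>2 \<le> M1\<^sup>2 * B * d k"
      proof -
        have "M1\<^sup>2 * (d k * d k) \<le> M1\<^sup>2 * (B * d k)"
          using dB d0[of k] by (intro mult_left_mono mult_right_mono) auto
        then show ?thesis by (simp add: power_mult_distrib power2_eq_square mult_ac)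
      qed
      finally show ?thesis using Yb by (simp add: T_def algebra_simps)
    qed
    then show ?thesis
      by (intro exI[of _ k0] exI[of _ "\<lambda>_. T"]) (use T in \<open>auto simp: d_def k0_def\<close>)
  qed
  show ?thesis using part_a part_b by blast
qed

end
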